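(* Let $A_\alpha$ ($\alpha=0,1,2,3$) be $\mathfrak g$-valued functions in $\mathcal S(\mathbb R^{1+3})$ satisfying the Lorenz gauge condition $\partial^\alpha A_\alpha=0$, and let $F_{\alpha\beta}=\partial_\alpha A_\beta-\partial_\beta A_\alpha+[A_\alpha,A_\beta]$. Then for each $\beta\in\{0,1,2,3\}$, $$[A^\alpha,\partial_\beta A_\alpha]=\sum_{i=1}^4\Gamma^i_\beta(A,\partial A,F,\partial F),$$ where $$\Gamma^1_\beta=-[A_0,\partial_\beta A_0]+[\langle\nabla\rangle^{-1}R_j(\partial_tA_0),\langle\nabla\rangle^{-1}R^j\partial_t(\partial_\beta A_0)],$$ $$\Gamma^2_\beta=-\tfrac12\varepsilon^{ijk}\varepsilon_{klm}\Big\{Q_{ij}[\langle\nabla\rangle^{-1}R^n\mathbf A_n,\langle\nabla\rangle^{-1}R^l\partial_\beta\mathbf A^m]-Q_{ij}[\langle\nabla\rangle^{-1}R^n\partial_\beta\mathbf A_n,\langle\nabla\rangle^{-1}R^l\mathbf A^m]\Big\},$$ $$\begin{aligned}\Gamma^3_\beta&=[\langle\nabla\rangle^{-2}\nabla\times\mathbf F,\langle\nabla\rangle^{-2}\nabla\times\partial_\beta\mathbf F]-[\langle\nabla\rangle^{-2}\nabla\times\mathbf F,\langle\nabla\rangle^{-2}\partial_\beta\nabla\times(\mathbf A\times\mathbf A)]\\&\quad-[\langle\nabla\rangle^{-2}\nabla\times(\mathbf A\times\mathbf A),\langle\nabla\rangle^{-2}\nabla\times\partial_\beta\mathbf F]+[\langle\nabla\rangle^{-2}\nabla\times(\mathbf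 A\times\mathbf A),\langle\nabla\rangle^{-2}\partial_\beta\nabla\times(\mathbf A\times\mathbf A)],\end{aligned}$$ $$\Gamma^4_\beta=[\mathbf A^{\mathrm{cf}}+\mathbf A^{\mathrm{df}},\langle\nabla\rangle^{-2}\partial_\beta\mathbf A]+[\langle\nabla\rangle^{-2}\mathbf A,\partial_\beta\mathbf A].$$
   Context: $\mathfrak g$ is $so(n,\mathbb R)$ or $su(n,\mathbb C)$, and $[\cdot,\cdot]$ is the matrix commutator. Greek indices run over $0,1,2,3$, Roman over $1,2,3$; indices are raised and lowered with $\mathrm{diag}(-1,1,1,1)$ and repeated upper/lower indices are summed; $\partial_\alpha=\partial/\partial x^\alpha$ with $t=x^0$, $\partial_t=\partial_0$, $\nabla=(\partial_1,\partial_2,\partial_3)$. $\langle\nabla\rangle=(1-\Delta)^{1/2}$ and $R_i=\langle\nabla\rangle^{-1}\partial_i$. $\varepsilon_{ijk}$ is the antisymmetric symbol with $\varepsilon_{123}=1$. For $\mathfrak g$-valued $u,v$, $$Q_{\alpha\beta}[u,v]=[\partial_\alpha u,\partial_\beta v]-[\partial_\beta u,\partial_\alpha v].$$ $\mathbf A=(A_1,A_2,A_3)$ and $\mathbf F=(F_{23},F_{31},F_{12})$. For matrix-valued vector fields $\mathbf U,\mathbf V$ with three components: $[\mathbf U,\mathbf V]=[U^i,V_i]$, $(\mathbf U\times\mathbf V)^i=\varepsilon^{ijk}U_jV_k$ (matrix products in this order), $(\nabla\times\mathbf V)^i=\varepsilon^{ijk}\partial_jV_k$. Further, $$\mathbf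 A^{\mathrm{df}}=\langle\nabla\rangle^{-2}\nabla\times\nabla\times\mathbf A,\qquad \mathbf A^{\mathrm{cf}}=-\langle\nabla\rangle^{-2}\nabla(\nabla\cdot\mathbf A),$$ so that $\mathbf A=\mathbf A^{\mathrm{df}}+\mathbf A^{\mathrm{cf}}+\langle\nabla\rangle^{-2}\mathbf A$. *)

theory Defs
  imports "HOL-Analysis.Analysis"
begin

text \<open>
  Points of \<open>\<real>\<^sup>1\<^sup>+\<^sup>3\<close> are pairs \<open>(t, x)\<close>. Greek indices are the natural numbers \<open>0..3\<close>,
  Roman indices the natural numbers \<open>1..3\<close>; \<open>of_nat\<close> sends \<open>1, 2, 3\<close> to the three elements
  of the index type \<open>3\<close> (where \<open>3 = 0\<close>). Indices above \<open>3\<close> are never used.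
\<close>

type_synonym spacetime = "real \<times> (real ^ 3)"

definition basis_vec :: "nat \<Rightarrow> spacetime" where
  "basis_vec \<mu> = (if \<mu> = 0 then (1, 0) else (0, axis (of_nat \<mu>) 1))"

definition pd :: "nat \<Rightarrow> (spacetime \<Rightarrow> 'b::real_normed_vector) \<Rightarrow> spacetime \<Rightarrow> 'b" where
  "pd \<mu> f x = vector_derivative (\<lambda>s. f (x + s *\<^sub>R basis_vec \<mu>)) (at 0)"

definition schwartz :: "(spacetime \<Rightarrow> 'b::real_normed_vector) \<Rightarrow> bool" where
  "schwartz f \<longleftrightarrow>
    (\<forall>\<mu>s. set \<mu>s \<subseteq> {0..3} \<longrightarrow>
      (\<forall>x. foldr pd \<mu>s f differentiable (at x)) \<and>
      (\<forall>k::nat. \<exists>C. \<forall>x. norm x ^ k * norm (foldr pd \<mu>s f x) \<le> C))"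

text \<open>
  Both algebras live in the complex matrices; \<open>so(n,\<real>)\<close> consists of those skew-symmetric
  matrices whose entries are all real.
\<close>

definition so_real :: "(complex ^ 'n ^ 'n) set" where
  "so_real = {M. (\<forall>a b. M $ a $ b \<in> \<real>) \<and> transpose M = - M}"

definition su_complex :: "(complex ^ 'n ^ 'n) set" where
  "su_complex = {M. (\<chi> a b. cnj (M $ b $ a)) = - M \<and> trace M = 0}"

definition comm :: "complex ^ 'n ^ 'n \<Rightarrow> complex ^ 'n ^ 'n \<Rightarrow> complex ^ 'n ^ 'n" where
  "comm X Y = X ** Y - Y ** X"

type_synonym 'n field = "spacetime \<Rightarrow> complex ^ 'n ^ 'n"

definition fourier :: "(real ^ 3 \<Rightarrow> complex) \<Rightarrow> real ^ 3 \<Rightarrow> complex" where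
  "fourier f \<xi> = (LINT x|lborel. cis (- (x \<bullet> \<xi>)) * f x)"

definition inv_fourier :: "(real ^ 3 \<Rightarrow> complex) \<Rightarrow> real ^ 3 \<Rightarrow> complex" where
  "inv_fourier g x = complex_of_real (1 / (2 * pi) ^ 3) * (LINT \<xi>|lborel. cis (x \<bullet> \<xi>) * g \<xi>)"

text \<open>
  \<open>jap s\<close> is \<open>\<langle>\<nabla>\<rangle>\<^sup>s = (1 - \<Delta>)\<^sup>s\<^sup>/\<^sup>2\<close>, acting at each fixed time and on each matrix entry.
\<close>

definition jap :: "real \<Rightarrow> 'n::finite field \<Rightarrow> 'n field" where
  "jap s u = (\<lambda>(t, x). \<chi> a b.
     inv_fourier (\<lambda>\<xi>. complex_of_real ((1 + (norm \<xi>)\<^sup>2) powr (s / 2)) *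
                       fourier (\<lambda>y. u (t, y) $ a $ b) \<xi>) x)"

definition riesz :: "nat \<Rightarrow> 'n::finite field \<Rightarrow> 'n field" where
  "riesz i u = jap (- 1) (pd i u)"

text \<open>
  Only the time index changes sign when raised, so upper and lower Roman indices are not
  distinguished.
\<close>

definition raise :: "(nat \<Rightarrow> 'b::real_vector) \<Rightarrow> nat \<Rightarrow> 'b" where
  "raise a \<alpha> = (if \<alpha> = 0 then - a \<alpha> else a \<alpha>)"

definition eps :: "nat \<Rightarrow> nat \<Rightarrow> nat \<Rightarrow> real" where
  "eps i j k =
    (if (i, j, k) \<in> {(1, 2, 3), (2, 3, 1), (3, 1, 2)} then 1
     else if (i, j, k) \<in> {(1, 3, 2), (3, 2, 1), (2, 1, 3)} then - 1
     else 0)"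

definition Q :: "nat \<Rightarrow> nat \<Rightarrow> 'n::finite field \<Rightarrow> 'n field \<Rightarrow> 'n field" where
  "Q \<alpha> \<beta> u v x = comm (pd \<alpha> u x) (pd \<beta> v x) - comm (pd \<beta> u x) (pd \<alpha> v x)"

text \<open>
  A three-component field is a family indexed by \<open>1, 2, 3\<close>. A potential \<open>(A\<^sub>0, \<dots>, A\<^sub>3)\<close> also
  serves as its spatial part, since the operations below ignore the component of index \<open>0\<close>.
\<close>

definition vcomm :: "(nat \<Rightarrow> 'n::finite field) \<Rightarrow> (nat \<Rightarrow> 'n field) \<Rightarrow> 'n field" where
  "vcomm U V x = (\<Sum>i=1..3. comm (U i x) (V i x))"

definition vcross :: "(nat \<Rightarrow> 'n::finite field) \<Rightarrow> (nat \<Rightarrow> 'n field) \<Rightarrow> nat \<Rightarrow> 'n field" where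
  "vcross U V i x = (\<Sum>j=1..3. \<Sum>k=1..3. eps i j k *\<^sub>R (U j x ** V k x))"

definition curl :: "(nat \<Rightarrow> 'n::finite field) \<Rightarrow> nat \<Rightarrow> 'n field" where
  "curl V i x = (\<Sum>j=1..3. \<Sum>k=1..3. eps i j k *\<^sub>R pd j (V k) x)"

definition divergence :: "(nat \<Rightarrow> 'n::finite field) \<Rightarrow> 'n field" where
  "divergence V x = (\<Sum>i=1..3. pd i (V i) x)"

definition df_part :: "(nat \<Rightarrow> 'n::finite field) \<Rightarrow> nat \<Rightarrow> 'n field" where
  "df_part A i = jap (- 2) (curl (curl A) i)"

definition cf_part :: "(nat \<Rightarrow> 'n::finite field) \<Rightarrow> nat \<Rightarrow> 'n field" where
  "cf_part A i x = - jap (- 2) (pd i (divergence A)) x"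

definition lorenz_gauge :: "(nat \<Rightarrow> 'n::finite field) \<Rightarrow> bool" where
  "lorenz_gauge A \<longleftrightarrow> (\<forall>x. (\<Sum>\<alpha>=0..3. raise (\<lambda>\<mu>. pd \<mu> (A \<alpha>) x) \<alpha>) = 0)"

definition curvature :: "(nat \<Rightarrow> 'n::finite field) \<Rightarrow> nat \<Rightarrow> nat \<Rightarrow> 'n field" where
  "curvature A \<alpha> \<beta> x = pd \<alpha> (A \<beta>) x - pd \<beta> (A \<alpha>) x + comm (A \<alpha> x) (A \<beta> x)"

definition spatial_curvature :: "(nat \<Rightarrow> nat \<Rightarrow> 'n::finite field) \<Rightarrow> nat \<Rightarrow> 'n field" where
  "spatial_curvature F i =
    (if i = 1 then F 2 3 else if i = 2 then F 3 1 else if i = 3 then F 1 2 else (\<lambda>x. 0))"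

definition Gamma1 :: "(nat \<Rightarrow> 'n::finite field) \<Rightarrow> nat \<Rightarrow> 'n field" where
  "Gamma1 A \<beta> x =
     - comm (A 0 x) (pd \<beta> (A 0) x)
     + (\<Sum>j=1..3. comm (jap (- 1) (riesz j (pd 0 (A 0))) x)
                       (jap (- 1) (riesz j (pd 0 (pd \<beta> (A 0)))) x))"

definition Gamma2 :: "(nat \<Rightarrow> 'n::finite field) \<Rightarrow> nat \<Rightarrow> 'n field" where
  "Gamma2 A \<beta> x =
     - (1/2) *\<^sub>R (\<Sum>i=1..3. \<Sum>j=1..3. \<Sum>k=1..3. \<Sum>l=1..3. \<Sum>m=1..3.
         (eps i j k * eps k l m) *\<^sub>R
         (Q i j (\<lambda>y. \<Sum>n=1..3. jap (- 1) (riesz n (A n)) y)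
                (jap (- 1) (riesz l (pd \<beta> (A m)))) x
        - Q i j (\<lambda>y. \<Sum>n=1..3. jap (- 1) (riesz n (pd \<beta> (A n))) y)
                (jap (- 1) (riesz l (A m))) x))"

definition Gamma3 ::
  "(nat \<Rightarrow> 'n::finite field) \<Rightarrow> (nat \<Rightarrow> nat \<Rightarrow> 'n field) \<Rightarrow> nat \<Rightarrow> 'n field" where
  "Gamma3 A F \<beta> x =
    (let \<F> = spatial_curvature F;
         cF = (\<lambda>i. jap (- 2) (curl \<F> i));
         cdF = (\<lambda>i. jap (- 2) (curl (\<lambda>k. pd \<beta> (\<F> k)) i));
         cAA = (\<lambda>i. jap (- 2) (curl (vcross A A) i));
         dcAA = (\<lambda>i. jap (- 2) (pd \<beta> (curl (vcross A A) i)))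
     in vcomm cF cdF x - vcomm cF dcAA x - vcomm cAA cdF x + vcomm cAA dcAA x)"

definition Gamma4 :: "(nat \<Rightarrow> 'n::finite field) \<Rightarrow> nat \<Rightarrow> 'n field" where
  "Gamma4 A \<beta> x =
     vcomm (\<lambda>i y. cf_part A i y + df_part A i y) (\<lambda>i. jap (- 2) (pd \<beta> (A i))) x
     + vcomm (\<lambda>i. jap (- 2) (A i)) (\<lambda>i. pd \<beta> (A i)) x"

end

theory Submission
  imports Defs "HOL-Probability.Characteristic_Functions" "HOL-Probability.Sinc_Integral"
begin

text \<open>
  Put \<open>J = \<langle>\<nabla>\<rangle>\<^sup>-\<^sup>2\<close>. Since \<open>J\<close> inverts \<open>1 - \<Delta>\<close> and the curl of the curl is the gradient of the divergence
  minus the Laplacian, the spatial potential splits into its curl-free part, its divergence-free part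
  and \<open>J A\<close> (\<open>hodge_decomposition\<close>). Insert this into \<open>[A, \<partial>\<^sub>\<beta> A]\<close>. All terms with a factor \<open>J A\<close> or
  \<open>J \<partial>\<^sub>\<beta> A\<close> make up \<open>Gamma4\<close>, and three kinds of products of the first two parts remain.
  The curl-free part is the gradient of \<open>- J (\<nabla> \<cdot> A)\<close>, where the divergence is the time derivative of \<open>A 0\<close>
  by the gauge condition; its product with itself gives \<open>Gamma1\<close> (\<open>Gamma1_eq\<close>). The divergence-free part is
  \<open>J\<close> applied to the curl of \<open>F - A \<times> A\<close>; its product with itself gives \<open>Gamma3\<close> (\<open>Gamma3_eq\<close>). In the mixed
  products a gradient meets a curl, so only the part antisymmetric in the two derivatives survives, and
  these are the null forms of \<open>Gamma2\<close> (\<open>Gamma2_eq\<close>).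

  What needs work is the calculus of \<open>J\<close>: linearity, \<open>\<langle>\<nabla>\<rangle>\<^sup>-\<^sup>1\<langle>\<nabla>\<rangle>\<^sup>-\<^sup>1 = J\<close>, \<open>J (1 - \<Delta>) = 1\<close>, and that \<open>J\<close> commutes with
  derivatives in space and time. Each of these is trivial after a Fourier transform in space, so it
  suffices to have a class of functions, preserved by all the operators involved, on which the
  transform is invertible (\<open>fourier_inversion\<close>) and turns spatial derivatives into multiplication by
  coordinates (\<open>fourier_space_pd_space\<close>). The class \<open>rapid\<close> serves this purpose: functions that decrease rapidly in space
  uniformly in time. It is defined coinductively by its closure properties, contains the Schwartz
  functions (\<open>schwartz_imp_rapid\<close>), and is preserved by products, by multiplication with \<open>\<langle>\<xi>\<rangle>\<^sup>s\<close> for \<open>s \<le> 0\<close>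
  (\<open>rapid_jap_symbol_mult\<close>), and by the transform (\<open>rapid_fourier_space\<close>).
\<close>

section \<open>Gaussian integrals and Fourier inversion\<close>

lemma
  fixes f :: "'a::euclidean_space \<Rightarrow> real \<Rightarrow> 'b::{real_normed_field,banach,second_countable_topology}"
  assumes f: "\<And>b. b \<in> Basis \<Longrightarrow> integrable lborel (f b)"
  shows integrable_lborel_prod: "integrable lborel (\<lambda>x::'a. \<Prod>b\<in>Basis. f b (x \<bullet> b))"
    and integral_lborel_prod:
      "(LINT x|lborel. (\<Prod>b\<in>Basis. f b (x \<bullet> b))) = (\<Prod>b\<in>Basis. LINT s|lborel. f b s)"
proof -
  interpret product_sigma_finite "\<lambda>_::'a. lborel :: real measure" by standard
  have [measurable]: "f b \<in> borel_measurable borel" if "b \<in> Basis" for b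
    using borel_measurable_integrable[OF f[OF that]] by simp
  have m: "(\<lambda>x::'a. \<Prod>b\<in>Basis. f b (x \<bullet> b)) \<in> borel_measurable borel"
    by measurable
  have e: "(\<Prod>b\<in>Basis. f b ((\<Sum>c\<in>Basis. g c *\<^sub>R c) \<bullet> b)) = (\<Prod>b\<in>Basis. f b (g b))" for g :: "'a \<Rightarrow> real"
    by (intro prod.cong refl) simp
  have T: "(\<lambda>g. \<Sum>b\<in>(Basis::'a set). g b *\<^sub>R b) \<in> (\<Pi>\<^sub>M b\<in>(Basis::'a set). (lborel::real measure)) \<rightarrow>\<^sub>M borel"
    by measurable
  show "integrable lborel (\<lambda>x::'a. \<Prod>b\<in>Basis. f b (x \<bullet> b))"
    unfolding lborel_eq[where 'a='a]
    by (subst integrable_distr_eq[OF T m]) (simp add: e product_integrable_prod f)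
  show "(LINT x|lborel. (\<Prod>b\<in>Basis. f b (x \<bullet> b))) = (\<Prod>b\<in>Basis. LINT s|lborel. f b s)"
    unfolding lborel_eq[where 'a='a]
    by (subst integral_distr[OF T m]) (simp add: e product_integral_prod f)
qed

text \<open>
An integrable majorant. Its reciprocal is a polynomial in the coordinates, so in a class of bounded
functions closed under sums and multiplication by coordinates every member is bounded by a multiple of
\<open>weight\<close> and hence integrable.
\<close>

definition weight :: "'a::euclidean_space \<Rightarrow> real" where
  "weight x = (\<Prod>b\<in>Basis. 1 / (1 + (x \<bullet> b)\<^sup>2))"

lemma weight_pos: "weight x > 0"
  unfolding weight_def by (intro prod_pos) (auto simp: add_pos_nonneg)

lemma integrable_inverse_square_line: "integrable lborel (\<lambda>s::real. 1 / (1 + s\<^sup>2))"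
  using integrable_inverse_1_plus_square by (simp add: set_integrable_def field_simps)

lemma integrable_weight: "integrable lborel (weight :: 'a::euclidean_space \<Rightarrow> real)"
  unfolding weight_def[abs_def] using integrable_lborel_prod[where f="\<lambda>_ s. 1 / (1 + s\<^sup>2) :: real"]
  by (simp add: integrable_inverse_square_line)

lemma
  fixes f :: "'a::euclidean_space \<Rightarrow> 'b::{banach,second_countable_topology}"
  assumes c: "c \<noteq> 0" and f: "f \<in> borel_measurable borel"
  shows integrable_lborel_affine_iff: "integrable lborel (\<lambda>x. f (t + c *\<^sub>R x)) \<longleftrightarrow> integrable lborel f" (is ?A)
    and integral_lborel_affine:
      "(LINT x|lborel. f x) = \<bar>c\<bar> ^ DIM('a) *\<^sub>R (LINT x|lborel. f (t + c *\<^sub>R x))" (is ?B)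
proof -
  note [measurable] = f
  have "integrable lborel f \<longleftrightarrow>
      integrable (density (distr lborel borel (\<lambda>x. t + c *\<^sub>R x)) (\<lambda>_. \<bar>c\<bar>^DIM('a))) f"
    by (subst lborel_affine[OF c, of t]) simp
  also have "\<dots> \<longleftrightarrow> integrable lborel (\<lambda>x. f (t + c *\<^sub>R x))"
  proof -
    have "integrable lborel (\<lambda>x. (1 / \<bar>c\<bar> ^ DIM('a)) *\<^sub>R \<bar>c\<bar> ^ DIM('a) *\<^sub>R f (t + c *\<^sub>R x))"
      if "integrable lborel (\<lambda>x. \<bar>c\<bar> ^ DIM('a) *\<^sub>R f (t + c *\<^sub>R x))"
      using that by (rule integrable_scaleR_right)
    hence "integrable lborel (\<lambda>x. \<bar>c\<bar> ^ DIM('a) *\<^sub>R f (t + c *\<^sub>R x)) \<longleftrightarrow>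
        integrable lborel (\<lambda>x. f (t + c *\<^sub>R x))"
      using c by auto
    thus ?thesis
      using c by (subst integrable_density) (simp_all add: integrable_distr_eq)
  qed
  finally show ?A ..
  have "(LINT x|lborel. f x) =
      (LINT x|(density (distr lborel borel (\<lambda>x. t + c *\<^sub>R x)) (\<lambda>_. \<bar>c\<bar>^DIM('a))). f x)"
    by (subst lborel_affine[OF c, of t]) simp
  also have "\<dots> = \<bar>c\<bar> ^ DIM('a) *\<^sub>R (LINT x|lborel. f (t + c *\<^sub>R x))"
    using c by (subst integral_density) (auto simp: integral_distr)
  finally show ?B .
qed

text \<open>
The standard normal density is, up to normalisation, its own characteristic function; this is the only Fourier transform
that is computed explicitly.
\<close>

lemma integral_gaussian_line:
  "integrable lborel (\<lambda>s::real. cis (a * s) * complex_of_real (exp (- s\<^sup>2 / 2)))"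
  "(LINT s|lborel. cis (a * s) * complex_of_real (exp (- s\<^sup>2 / 2))) =
     complex_of_real (sqrt (2 * pi) * exp (- a\<^sup>2 / 2))"
proof -
  have d: "std_normal_density s *\<^sub>R cis (a * s) =
      complex_of_real (1 / sqrt (2 * pi)) * (cis (a * s) * complex_of_real (exp (- s\<^sup>2 / 2)))" for s
    by (simp add: std_normal_density_def scaleR_conv_of_real mult_ac)
  have i: "integrable lborel (\<lambda>s::real. exp (- s\<^sup>2 / 2))"
  proof -
    have "integrable lborel (\<lambda>s. sqrt (2 * pi) * std_normal_density s)"
      using integrable_normal_density[of 1 0] by simp
    thus ?thesis by (simp add: std_normal_density_def)
  qed
  show I: "integrable lborel (\<lambda>s::real. cis (a * s) * complex_of_real (exp (- s\<^sup>2 / 2)))"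
    by (rule Bochner_Integration.integrable_bound[OF i])
       (auto simp: norm_mult cis_conv_exp intro!: borel_measurable_continuous_onI continuous_intros)
  have "complex_of_real (exp (- a\<^sup>2 / 2)) = char std_normal_distribution a"
    by (simp add: char_std_normal_distribution)
  also have "\<dots> = (LINT s|lborel. std_normal_density s *\<^sub>R cis (a * s))"
  proof -
    have [measurable]: "(\<lambda>s. cis (a * s)) \<in> borel_measurable borel"
      by (intro borel_measurable_continuous_onI continuous_intros)
    show ?thesis
      unfolding char_def cis_conv_exp[symmetric]
      by (subst integral_density) (simp_all add: normal_density_nonneg)
  qed
  also have "\<dots> = complex_of_real (1 / sqrt (2 * pi)) * (LINT s|lborel. cis (a * s) * complex_of_real (exp (- s\<^sup>2 / 2)))"
    unfolding d using I by simp
  finally have E: "complex_of_real (exp (- a\<^sup>2 / 2)) = \<dots>" .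
  have "complex_of_real (sqrt (2 * pi)) * complex_of_real (1 / sqrt (2 * pi)) = 1"
    by (simp flip: of_real_mult)
  thus "(LINT s|lborel. cis (a * s) * complex_of_real (exp (- s\<^sup>2 / 2))) =
     complex_of_real (sqrt (2 * pi) * exp (- a\<^sup>2 / 2))"
    by (simp only: of_real_mult E mult.assoc[symmetric] mult_1_left)
qed

definition gaussian :: "'a::euclidean_space \<Rightarrow> real" where
  "gaussian x = exp (- (norm x)\<^sup>2 / 2)"

lemma gaussian_prod: "gaussian x = (\<Prod>b\<in>Basis. exp (- (x \<bullet> b)\<^sup>2 / 2))"
proof -
  have "(norm x)\<^sup>2 = (\<Sum>b\<in>Basis. (x \<bullet> b)\<^sup>2)"
    unfolding power2_norm_eq_inner euclidean_inner[of x x] by (simp add: power2_eq_square)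
  thus ?thesis
    by (simp add: gaussian_def sum_negf sum_divide_distrib flip: exp_sum)
qed

lemma cis_inner_prod: "cis (a \<bullet> x) = (\<Prod>b\<in>Basis. cis ((a \<bullet> b) * (x \<bullet> b)))"
  by (subst euclidean_inner) (simp add: cis_conv_exp exp_sum sum_distrib_left)

lemma
  fixes a :: "'a::euclidean_space"
  shows integrable_gaussian: "integrable lborel (\<lambda>x. cis (a \<bullet> x) * complex_of_real (gaussian x))"
    and integral_gaussian: "(LINT x|lborel. cis (a \<bullet> x) * complex_of_real (gaussian x)) =
     complex_of_real (sqrt (2 * pi) ^ DIM('a) * gaussian a)"
proof -
  have e: "cis (a \<bullet> x) * complex_of_real (gaussian x) =
     (\<Prod>b\<in>Basis. cis ((a \<bullet> b) * (x \<bullet> b)) * complex_of_real (exp (- (x \<bullet> b)\<^sup>2 / 2)))" for x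
    by (simp add: cis_inner_prod gaussian_prod prod.distrib)
  show "integrable lborel (\<lambda>x. cis (a \<bullet> x) * complex_of_real (gaussian x))"
    unfolding e by (rule integrable_lborel_prod[where f="\<lambda>b s. cis ((a \<bullet> b) * s) * complex_of_real (exp (- s\<^sup>2 / 2))"]) (rule integral_gaussian_line)
  show "(LINT x|lborel. cis (a \<bullet> x) * complex_of_real (gaussian x)) =
     complex_of_real (sqrt (2 * pi) ^ DIM('a) * gaussian a)"
    unfolding e by (subst integral_lborel_prod[where f="\<lambda>b s. cis ((a \<bullet> b) * s) * complex_of_real (exp (- s\<^sup>2 / 2))"])
      (simp_all only: integral_gaussian_line gaussian_prod of_real_mult of_real_power of_real_prod prod.distrib prod_constant)
qed

lemma gaussian_le_1: "gaussian x \<le> 1" and gaussian_pos: "gaussian x > 0"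
    and gaussian_nonneg [simp]: "0 \<le> gaussian x" and abs_gaussian [simp]: "\<bar>gaussian x\<bar> = gaussian x"
  by (simp_all add: gaussian_def)

lemma continuous_gaussian [continuous_intros]:
  "continuous_on S f \<Longrightarrow> continuous_on S (\<lambda>x. gaussian (f x))"
  unfolding gaussian_def by (intro continuous_intros) auto

lemma integral_scaled_gaussian:
  fixes z :: "'a::euclidean_space"
  assumes e: "e > 0"
  shows "integrable lborel (\<lambda>y. cis (z \<bullet> y) * complex_of_real (gaussian (e *\<^sub>R y)))"
    and "complex_of_real (e ^ DIM('a)) * (LINT y|lborel. cis (z \<bullet> y) * complex_of_real (gaussian (e *\<^sub>R y))) =
      complex_of_real (sqrt (2 * pi) ^ DIM('a) * gaussian ((1 / e) *\<^sub>R z))"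
proof -
  let ?F = "\<lambda>y. cis (((1 / e) *\<^sub>R z) \<bullet> y) * complex_of_real (gaussian y)"
  have m: "?F \<in> borel_measurable borel"
    by (intro borel_measurable_continuous_onI continuous_intros)
  have r: "?F (0 + e *\<^sub>R y) = cis (z \<bullet> y) * complex_of_real (gaussian (e *\<^sub>R y))" for y
    using e by simp
  show "integrable lborel (\<lambda>y. cis (z \<bullet> y) * complex_of_real (gaussian (e *\<^sub>R y)))"
    using integrable_lborel_affine_iff[OF _ m, of e 0] e integrable_gaussian[of "(1 / e) *\<^sub>R z"]
    unfolding r by simp
  have "complex_of_real (sqrt (2 * pi) ^ DIM('a) * gaussian ((1 / e) *\<^sub>R z)) = (LINT y|lborel. ?F y)"
    by (rule integral_gaussian[symmetric])
  also have "\<dots> = \<bar>e\<bar> ^ DIM('a) *\<^sub>R (LINT y|lborel. ?F (0 + e *\<^sub>R y))"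
    using e by (intro integral_lborel_affine m) auto
  finally show "complex_of_real (e ^ DIM('a)) * (LINT y|lborel. cis (z \<bullet> y) * complex_of_real (gaussian (e *\<^sub>R y))) =
      complex_of_real (sqrt (2 * pi) ^ DIM('a) * gaussian ((1 / e) *\<^sub>R z))"
    unfolding r using e by (simp add: scaleR_conv_of_real)
qed

text \<open>
A Gaussian factor makes the double integral behind the inversion formula absolutely convergent.
Fubini's theorem then moves the transform from \<open>f\<close> to the Gaussian, and rescaling by \<open>e\<close> leaves a
Gaussian average of \<open>f\<close> around \<open>x\<close>.
\<close>

lemma fourier_gaussian_regularised:
  fixes f :: "real ^ 3 \<Rightarrow> complex"
  assumes e: "e > 0" and c: "continuous_on UNIV f" and i: "integrable lborel f"
  shows "(LINT \<xi>|lborel. cis (x \<bullet> \<xi>) * complex_of_real (gaussian (e *\<^sub>R \<xi>)) * fourier f \<xi>) =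
     complex_of_real (sqrt (2 * pi) ^ 3) * (LINT w|lborel. f (x + e *\<^sub>R w) * complex_of_real (gaussian w))"
proof -
  define h where "h \<xi> y = cis (x \<bullet> \<xi>) * complex_of_real (gaussian (e *\<^sub>R \<xi>)) * (cis (- (y \<bullet> \<xi>)) * f y)" for \<xi> y
  have n: "norm (h \<xi> y) = gaussian (e *\<^sub>R \<xi>) * norm (f y)" for \<xi> y
    using gaussian_pos[of "e *\<^sub>R \<xi>"] by (simp add: h_def norm_mult)
  have ih: "integrable lborel (h \<xi>)" for \<xi>
    unfolding h_def
    by (intro integrable_mult_right Bochner_Integration.integrable_bound[OF i])
       (auto simp: norm_mult intro!: borel_measurable_continuous_onI continuous_intros c)
  have ig: "integrable lborel (\<lambda>\<xi>::real^3. gaussian (e *\<^sub>R \<xi>))"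
    using integrable_norm[OF integral_scaled_gaussian(1)[OF e, of "0::real^3"]]
      gaussian_pos by (simp add: less_imp_le norm_mult)
  have "continuous_on UNIV (\<lambda>p. h (fst p) (snd p))"
    unfolding h_def by (intro continuous_intros continuous_on_compose2[OF c]) auto
  hence hm: "(\<lambda>p. h (fst p) (snd p)) \<in> borel_measurable (lborel \<Otimes>\<^sub>M lborel)"
    by (simp add: lborel_prod borel_measurable_continuous_onI)
  have hI: "integrable (lborel \<Otimes>\<^sub>M lborel) (\<lambda>(\<xi>, y). h \<xi> y)"
  proof (rule lborel_pair.Fubini_integrable)
    show "(\<lambda>(\<xi>, y). h \<xi> y) \<in> borel_measurable (lborel \<Otimes>\<^sub>M lborel)"
      using hm by (simp add: case_prod_beta')
    show "integrable lborel (\<lambda>\<xi>. LINT y|lborel. norm (case (\<xi>, y) of (\<xi>, y) \<Rightarrow> h \<xi> y))"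
      using ig by (simp add: n)
  qed (use ih in auto)
  have "(LINT \<xi>|lborel. cis (x \<bullet> \<xi>) * complex_of_real (gaussian (e *\<^sub>R \<xi>)) * fourier f \<xi>) =
      (LINT \<xi>|lborel. LINT y|lborel. h \<xi> y)"
    unfolding fourier_def h_def by simp
  also have "\<dots> = (LINT y|lborel. LINT \<xi>|lborel. h \<xi> y)"
    using lborel_pair.Fubini_integral[OF hI] by simp
  also have "\<dots> = (LINT y|lborel. f y * (LINT \<xi>|lborel. cis ((x - y) \<bullet> \<xi>) * complex_of_real (gaussian (e *\<^sub>R \<xi>))))"
  proof (intro Bochner_Integration.integral_cong refl)
    fix y
    have "h \<xi> y = f y * (cis ((x - y) \<bullet> \<xi>) * complex_of_real (gaussian (e *\<^sub>R \<xi>)))" for \<xi>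
      by (simp add: h_def inner_diff_left cis_mult mult_ac flip: mult.assoc[of "cis _" "cis _"])
    thus "(LINT \<xi>|lborel. h \<xi> y) = f y * (LINT \<xi>|lborel. cis ((x - y) \<bullet> \<xi>) * complex_of_real (gaussian (e *\<^sub>R \<xi>)))"
      by simp
  qed
  also have "\<dots> = (LINT y|lborel. f y * (complex_of_real (sqrt (2 * pi) ^ 3 / e ^ 3) * gaussian ((1 / e) *\<^sub>R (x - y))))"
    (is "_ = (LINT y|lborel. ?k y)")
  proof (intro Bochner_Integration.integral_cong refl arg_cong2[where f="(*)"])
    fix y
    show "(LINT \<xi>|lborel. cis ((x - y) \<bullet> \<xi>) * complex_of_real (gaussian (e *\<^sub>R \<xi>))) =
       complex_of_real (sqrt (2 * pi) ^ 3 / e ^ 3) * gaussian ((1 / e) *\<^sub>R (x - y))"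
    proof -
      have d: "DIM(real ^ 3) = 3" by simp
      have "(LINT \<xi>|lborel. cis ((x - y) \<bullet> \<xi>) * complex_of_real (gaussian (e *\<^sub>R \<xi>))) =
         complex_of_real (sqrt (2 * pi) ^ 3 * gaussian ((1 / e) *\<^sub>R (x - y))) / complex_of_real (e ^ 3)"
        using e by (subst integral_scaled_gaussian(2)[OF e, of "x - y", unfolded d, symmetric]) simp
      thus ?thesis by (simp only: of_real_mult of_real_divide times_divide_eq_left)
    qed
  qed
  also have "\<dots> = \<bar>e\<bar> ^ DIM(real ^ 3) *\<^sub>R (LINT w|lborel. ?k (x + e *\<^sub>R w))"
    using e by (intro integral_lborel_affine borel_measurable_continuous_onI continuous_intros c) auto
  also have "(\<lambda>w. ?k (x + e *\<^sub>R w)) =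
      (\<lambda>w. complex_of_real (sqrt (2 * pi) ^ 3 / e ^ 3) * (f (x + e *\<^sub>R w) * complex_of_real (gaussian w)))"
    using e by (auto simp: gaussian_def)
  finally show ?thesis
    using e by (simp add: scaleR_conv_of_real)
qed

text \<open>
The regularised formula as the width \<open>e\<close> of the Gaussian tends to \<open>0\<close>: dominated convergence
applies on the left because the transform of \<open>f\<close> is integrable, and on the right because \<open>f\<close> is
bounded and continuous.
\<close>

lemma fourier_inversion:
  fixes f :: "real ^ 3 \<Rightarrow> complex"
  assumes c: "continuous_on UNIV f" and B: "\<And>y. norm (f y) \<le> B"
    and i: "integrable lborel f" and i': "integrable lborel (fourier f)"
  shows "inv_fourier (fourier f) x = f x"
proof -
  define e where "e n = 1 / real (Suc n)" for n
  have e: "e n > 0" for n by (simp add: e_def)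
  have e0: "e \<longlonglongrightarrow> 0" unfolding e_def by (rule lim_1_over_n[THEN LIMSEQ_Suc])
  have [measurable]: "fourier f \<in> borel_measurable borel"
    using borel_measurable_integrable[OF i'] by simp
  have [measurable]: "(\<lambda>\<xi>. cis (x \<bullet> \<xi>)) \<in> borel_measurable borel"
      "\<And>s. (\<lambda>\<xi>::real^3. gaussian (s *\<^sub>R \<xi>)) \<in> borel_measurable borel"
      "(gaussian :: real^3 \<Rightarrow> real) \<in> borel_measurable borel"
    by (intro borel_measurable_continuous_onI continuous_intros)+
  have L: "(\<lambda>n. LINT \<xi>|lborel. cis (x \<bullet> \<xi>) * complex_of_real (gaussian (e n *\<^sub>R \<xi>)) * fourier f \<xi>)
      \<longlonglongrightarrow> (LINT \<xi>|lborel. cis (x \<bullet> \<xi>) * fourier f \<xi>)"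
  proof (rule integral_dominated_convergence[OF _ _ integrable_norm[OF i']])
    have "(\<lambda>n. cis (x \<bullet> \<xi>) * complex_of_real (gaussian (e n *\<^sub>R \<xi>)) * fourier f \<xi>)
        \<longlonglongrightarrow> cis (x \<bullet> \<xi>) * complex_of_real (gaussian (0 *\<^sub>R \<xi>)) * fourier f \<xi>" for \<xi>
      unfolding gaussian_def by (intro tendsto_intros e0) auto
    thus "AE \<xi> in lborel. (\<lambda>n. cis (x \<bullet> \<xi>) * complex_of_real (gaussian (e n *\<^sub>R \<xi>)) * fourier f \<xi>)
        \<longlonglongrightarrow> cis (x \<bullet> \<xi>) * fourier f \<xi>"
      by (simp add: gaussian_def)
    show "AE \<xi> in lborel. norm (cis (x \<bullet> \<xi>) * complex_of_real (gaussian (e n *\<^sub>R \<xi>)) * fourier f \<xi>) \<le> norm (fourier f \<xi>)" for n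
      using gaussian_le_1 gaussian_pos
      by (intro AE_I2) (auto simp: norm_mult less_imp_le intro!: mult_left_le_one_le)
  qed measurable
  have ig: "integrable lborel (\<lambda>w::real^3. gaussian w)"
    using integrable_norm[OF integrable_gaussian[of "0::real^3"]] gaussian_pos by (simp add: less_imp_le norm_mult)
  have R: "(\<lambda>n. LINT w|lborel. f (x + e n *\<^sub>R w) * complex_of_real (gaussian w))
      \<longlonglongrightarrow> (LINT w::real^3|lborel. f x * complex_of_real (gaussian w))"
  proof (rule integral_dominated_convergence[where w="\<lambda>w::real^3. B * gaussian w"])
    show "integrable lborel (\<lambda>w::real^3. B * gaussian w)" using ig by simp
    have "(\<lambda>n. f (x + e n *\<^sub>R w)) \<longlonglongrightarrow> f (x + 0 *\<^sub>R w)" for w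
      by (intro isCont_tendsto_compose[of _ f] tendsto_intros e0)
         (use c in \<open>simp add: continuous_on_eq_continuous_at\<close>)
    thus "AE w in lborel. (\<lambda>n. f (x + e n *\<^sub>R w) * complex_of_real (gaussian w)) \<longlonglongrightarrow> f x * complex_of_real (gaussian w)"
      by (intro AE_I2 tendsto_intros) simp
    show "AE w in lborel. norm (f (x + e n *\<^sub>R w) * complex_of_real (gaussian w)) \<le> B * gaussian w" for n
      using gaussian_pos B by (intro AE_I2) (auto simp: norm_mult less_imp_le intro!: mult_right_mono)
    show "(\<lambda>w. f (x + e n *\<^sub>R w) * complex_of_real (gaussian w)) \<in> borel_measurable lborel" for n
      using borel_measurable_continuous_onI[of "\<lambda>w. f (x + e n *\<^sub>R w)"]
      by (auto intro!: borel_measurable_continuous_onI continuous_intros continuous_on_compose2[OF c])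
  qed measurable
  \<comment> \<open>The transform and the mass of the Gaussian each contribute one factor \<open>(2 * pi) powr (3/2)\<close>.\<close>
  have K: "complex_of_real (sqrt (2 * pi) ^ 3) * complex_of_real (sqrt (2 * pi) ^ 3) = complex_of_real ((2 * pi) ^ 3)"
    by (simp only: of_real_mult[symmetric] power_mult_distrib[symmetric]) simp
  have "(LINT \<xi>|lborel. cis (x \<bullet> \<xi>) * fourier f \<xi>)
      = complex_of_real (sqrt (2 * pi) ^ 3) * (LINT w::real^3|lborel. f x * complex_of_real (gaussian w))"
    using L tendsto_mult_left[OF R, of "complex_of_real (sqrt (2 * pi) ^ 3)"]
    unfolding fourier_gaussian_regularised[OF e c i] by (rule LIMSEQ_unique)
  also have "\<dots> = complex_of_real ((2 * pi) ^ 3) * f x"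
    using integral_gaussian[of "0::real^3"] K by (simp add: gaussian_def mult_ac del: of_real_power of_real_mult)
  finally show ?thesis unfolding inv_fourier_def by simp
qed

section \<open>Differentiation under the integral sign\<close>

lemma has_vector_derivative_at_0_iff:
  "(f has_vector_derivative D) (at 0) \<longleftrightarrow> ((\<lambda>s. (1 / s) *\<^sub>R (f s - f 0)) \<longlongrightarrow> D) (at 0)"
proof -
  have "((\<lambda>s. norm (f s - f 0 - s *\<^sub>R D) / norm s) \<longlongrightarrow> 0) (at 0) \<longleftrightarrow>
      ((\<lambda>s. norm ((1 / s) *\<^sub>R (f s - f 0) - D)) \<longlongrightarrow> 0) (at 0)"
  proof (rule filterlim_cong[OF refl refl])
    have "norm (f s - f 0 - s *\<^sub>R D) / norm s = norm ((1 / s) *\<^sub>R (f s - f 0) - D)" if "s \<noteq> 0" for s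
    proof -
      have "(1 / s) *\<^sub>R (f s - f 0) - D = (1 / s) *\<^sub>R (f s - f 0 - s *\<^sub>R D)"
        using that by (simp add: scaleR_diff_right)
      thus ?thesis by simp
    qed
    thus "\<forall>\<^sub>F s in at 0. norm (f s - f 0 - s *\<^sub>R D) / norm s = norm ((1 / s) *\<^sub>R (f s - f 0) - D)"
      by (auto simp: eventually_at_filter)
  qed
  thus ?thesis
    by (simp add: has_vector_derivative_def has_derivative_iff_norm bounded_linear_scaleR_left
        tendsto_norm_zero_iff LIM_zero_iff)
qed

text \<open>
Only a bound for \<open>\<bar>s\<bar> \<le> 1\<close> is asked for, because the majorant of a translated function
is uniform only over bounded translations.
\<close>

lemma has_vector_derivative_integral:
  fixes h :: "real \<Rightarrow> 'a \<Rightarrow> 'b::{banach,second_countable_topology}"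
  assumes d: "\<And>s y. ((\<lambda>s. h s y) has_vector_derivative h' s y) (at s)"
    and b: "\<And>s y. \<bar>s\<bar> \<le> 1 \<Longrightarrow> norm (h' s y) \<le> w y"
    and i: "\<And>s. integrable M (h s)" and w: "integrable M w"
  shows "((\<lambda>s. LINT y|M. h s y) has_vector_derivative (LINT y|M. h' 0 y)) (at 0)"
    and "integrable M (h' 0)"
proof -
  \<comment> \<open>Mean value inequality: the difference quotients inherit the bound on the derivative.\<close>
  have q: "norm ((1 / s) *\<^sub>R (h s y - h 0 y)) \<le> w y" if s: "\<bar>s\<bar> \<le> 1" "s \<noteq> 0" for s y
  proof -
    have "norm (h s y - h 0 y) \<le> w y * norm (s - 0)"
    proof (rule differentiable_bound[where S="{-1..1}" and f'="\<lambda>r t. t *\<^sub>R h' r y"])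
      show "((\<lambda>s. h s y) has_derivative (\<lambda>t. t *\<^sub>R h' r y)) (at r within {-1..1})" for r
        using d[of y r] by (simp add: has_vector_derivative_def has_derivative_at_withinI)
      show "onorm (\<lambda>t. t *\<^sub>R h' r y) \<le> w y" if "r \<in> {-1..1}" for r
        using b[of r y] that order_trans[OF norm_ge_zero[of "h' r y"]]
        by (intro onorm_bound) (auto simp: mult.commute[of "w y"] abs_le_iff intro: mult_left_mono)
    qed (use s in auto)
    thus ?thesis using s unfolding norm_scaleR by (simp add: field_simps)
  qed
  have lim: "(\<lambda>n. (1 / X n) *\<^sub>R (h (X n) y - h 0 y)) \<longlonglongrightarrow> h' 0 y"
    if X: "\<forall>n. X n \<noteq> 0" "X \<longlonglongrightarrow> 0" for X :: "nat \<Rightarrow> real" and y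
    using d[of y 0] X by (auto simp: has_vector_derivative_at_0_iff tendsto_at_iff_sequentially o_def)
  have [measurable]: "h s \<in> borel_measurable M" for s
    using i by (rule borel_measurable_integrable)
  have m: "h' 0 \<in> borel_measurable M"
  proof (rule borel_measurable_LIMSEQ_metric)
    show "(\<lambda>n. (1 / (1 / real (Suc n))) *\<^sub>R (h (1 / real (Suc n)) y - h 0 y)) \<longlonglongrightarrow> h' 0 y" for y
      using lim_1_over_n[where 'a=real, THEN LIMSEQ_Suc] by (intro lim) simp_all
  qed measurable
  show "integrable M (h' 0)"
    using b[of 0] by (intro Bochner_Integration.integrable_bound[OF w m] AE_I2) (simp, meson abs_ge_self order_trans)
  show "((\<lambda>s. LINT y|M. h s y) has_vector_derivative (LINT y|M. h' 0 y)) (at 0)"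
    unfolding has_vector_derivative_at_0_iff tendsto_at_iff_sequentially o_def
  proof (intro allI impI)
    fix X :: "nat \<Rightarrow> real"
    assume "\<forall>n. X n \<in> UNIV - {0}" and X: "X \<longlonglongrightarrow> 0"
    hence X0: "\<forall>n. X n \<noteq> 0" by auto
    obtain N where N: "\<And>n. n \<ge> N \<Longrightarrow> \<bar>X n\<bar> \<le> 1"
      using LIMSEQ_D[OF X, of 1] by (force simp: less_imp_le)
    have "(\<lambda>n. LINT y|M. (1 / X (n + N)) *\<^sub>R (h (X (n + N)) y - h 0 y)) \<longlonglongrightarrow> (LINT y|M. h' 0 y)"
    proof (rule integral_dominated_convergence[OF m _ w])
      show "AE y in M. (\<lambda>n. (1 / X (n + N)) *\<^sub>R (h (X (n + N)) y - h 0 y)) \<longlonglongrightarrow> h' 0 y"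
        using X X0 by (intro AE_I2 lim LIMSEQ_ignore_initial_segment) auto
      show "AE y in M. norm ((1 / X (n + N)) *\<^sub>R (h (X (n + N)) y - h 0 y)) \<le> w y" for n
        using N X0 by (intro AE_I2 q) auto
    qed measurable
    hence "(\<lambda>n. (1 / X (n + N)) *\<^sub>R ((LINT y|M. h (X (n + N)) y) - (LINT y|M. h 0 y))) \<longlonglongrightarrow> (LINT y|M. h' 0 y)"
      using i by simp
    thus "(\<lambda>n. (1 / X n) *\<^sub>R ((LINT y|M. h (X n) y) - (LINT y|M. h 0 y))) \<longlonglongrightarrow> (LINT y|M. h' 0 y)"
      by (rule LIMSEQ_offset)
  qed
qed

section \<open>Functions decreasing rapidly in space\<close>

(* Points of spacetime are kept as single variables by the simplifier. *)
declare split_paired_All [simp del] split_paired_Ex [simp del]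

text \<open>
The total function \<open>pd\<close> yields a value even where no derivative exists; \<open>has_pd\<close> carries the
existence.
\<close>

definition has_pd :: "nat \<Rightarrow> (spacetime \<Rightarrow> 'b::real_normed_vector) \<Rightarrow> (spacetime \<Rightarrow> 'b) \<Rightarrow> bool" where
  "has_pd \<mu> f g \<longleftrightarrow> (\<forall>x. ((\<lambda>s. f (x + s *\<^sub>R basis_vec \<mu>)) has_vector_derivative g x) (at 0))"

lemma pd_eqI: "has_pd \<mu> f g \<Longrightarrow> pd \<mu> f = g"
  by (auto simp: has_pd_def pd_def fun_eq_iff intro: vector_derivative_at)

lemma has_pd_at:
  assumes "has_pd \<mu> f g"
  shows "((\<lambda>s. f (x + s *\<^sub>R basis_vec \<mu>)) has_vector_derivative g (x + r *\<^sub>R basis_vec \<mu>)) (at r)"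
proof -
  have "((\<lambda>s. f (x + r *\<^sub>R basis_vec \<mu> + s *\<^sub>R basis_vec \<mu>)) has_vector_derivative g (x + r *\<^sub>R basis_vec \<mu>)) (at 0)"
    using assms by (simp add: has_pd_def)
  moreover have "((\<lambda>s. s - r) has_vector_derivative 1) (at r)"
    by (auto intro!: derivative_eq_intros)
  ultimately have "((\<lambda>s. f (x + r *\<^sub>R basis_vec \<mu> + s *\<^sub>R basis_vec \<mu>)) \<circ> (\<lambda>s. s - r) has_vector_derivative
      1 *\<^sub>R g (x + r *\<^sub>R basis_vec \<mu>)) (at r)"
    by (intro vector_diff_chain_at) auto
  thus ?thesis by (simp add: o_def algebra_simps)
qed

lemma has_pd_add: "has_pd \<mu> f f' \<Longrightarrow> has_pd \<mu> g g' \<Longrightarrow> has_pd \<mu> (\<lambda>x. f x + g x) (\<lambda>x. f' x + g' x)"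
  by (auto simp: has_pd_def intro!: derivative_intros)

lemma has_pd_const: "has_pd \<mu> (\<lambda>x. c) (\<lambda>x. 0)"
  by (auto simp: has_pd_def intro!: derivative_intros)

lemma has_pd_linear: "bounded_linear L \<Longrightarrow> has_pd \<mu> f f' \<Longrightarrow> has_pd \<mu> (\<lambda>x. L (f x)) (\<lambda>x. L (f' x))"
  by (auto simp: has_pd_def intro: bounded_linear.has_vector_derivative)

lemma has_pd_mult:
  fixes f g :: "spacetime \<Rightarrow> 'b::real_normed_algebra"
  shows "has_pd \<mu> f f' \<Longrightarrow> has_pd \<mu> g g' \<Longrightarrow> has_pd \<mu> (\<lambda>x. f x * g x) (\<lambda>x. f x * g' x + f' x * g x)"
  unfolding has_pd_def
  by (rule allI, rule has_vector_derivative_eq_rhs[OF has_vector_derivative_mult]) auto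

lemma has_pd_cmult:
  fixes f :: "spacetime \<Rightarrow> complex"
  shows "has_pd \<mu> f f' \<Longrightarrow> has_pd \<mu> (\<lambda>x. c * f x) (\<lambda>x. c * f' x)"
  by (rule has_pd_linear[OF bounded_linear_mult_right])

definition coord :: "3 \<Rightarrow> spacetime \<Rightarrow> complex" where
  "coord j x = complex_of_real (snd x $ j)"

lemma has_pd_coord: "has_pd \<mu> (coord j) (\<lambda>x. complex_of_real (snd (basis_vec \<mu>) $ j))"
  unfolding has_pd_def coord_def by (auto intro!: derivative_eq_intros has_vector_derivative_of_real simp: algebra_simps)

lemma continuous_coord: "continuous_on S (coord j)"
  unfolding coord_def[abs_def] by (intro continuous_intros)

text \<open>
Functions that are Schwartz in space, with bounds uniform in time: the largest class of bounded
continuous functions closed under the partial derivatives and under multiplication by the spatial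
coordinates. Being the largest such class, it contains every set of functions with these
properties, which turns each closure statement below into a one-step computation. Time is a parameter
here: operators acting in space at each fixed time may be differentiated in time under the integral
sign as soon as the bounds are uniform in it.
\<close>

coinductive rapid :: "(spacetime \<Rightarrow> complex) \<Rightarrow> bool" where
  "continuous_on UNIV f \<Longrightarrow> bounded (range f) \<Longrightarrow>
   (\<forall>\<mu>\<le>3. has_pd \<mu> f (pd \<mu> f) \<and> rapid (pd \<mu> f)) \<Longrightarrow>
   (\<forall>j. rapid (\<lambda>x. coord j x * f x)) \<Longrightarrow> rapid f"

lemma rapid_continuous: "rapid f \<Longrightarrow> continuous_on UNIV f"
  and rapid_bounded: "rapid f \<Longrightarrow> bounded (range f)"
  and rapid_has_pd: "rapid f \<Longrightarrow> \<mu> \<le> 3 \<Longrightarrow> has_pd \<mu> f (pd \<mu> f)"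
  and rapid_pd: "rapid f \<Longrightarrow> \<mu> \<le> 3 \<Longrightarrow> rapid (pd \<mu> f)"
  and rapid_coord: "rapid f \<Longrightarrow> rapid (\<lambda>x. coord j x * f x)"
  by (auto elim: rapid.cases)

inductive linspan :: "((spacetime \<Rightarrow> complex) \<Rightarrow> bool) \<Rightarrow> (spacetime \<Rightarrow> complex) \<Rightarrow> bool" for X where
  base: "X f \<Longrightarrow> linspan X f"
| add: "linspan X f \<Longrightarrow> linspan X g \<Longrightarrow> linspan X (\<lambda>x. f x + g x)"
| scale: "linspan X f \<Longrightarrow> linspan X (\<lambda>x. c * f x)"

lemma linspan_coord:
  assumes f: "linspan X f" and X: "\<And>f. X f \<Longrightarrow> linspan X (\<lambda>x. coord j x * f x)"
  shows "linspan X (\<lambda>x. coord j x * f x)"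
  using f
proof induction
  case (add f g)
  thus ?case using linspan.add[OF add.IH] by (simp add: distrib_left)
next
  case (scale f c)
  thus ?case using linspan.scale[OF scale.IH, of c] by (simp add: mult_ac)
qed (rule X)

text \<open>
Coinduction up to linear combinations: by the product rule, the derivative of a member of the
candidate class \<open>X\<close> is usually a sum of members and not itself a member.
\<close>

lemma rapid_coinduct_linspan:
  assumes f: "linspan X f"
    and c: "\<And>f. X f \<Longrightarrow> continuous_on UNIV f"
    and b: "\<And>f. X f \<Longrightarrow> bounded (range f)"
    and d: "\<And>f \<mu>. X f \<Longrightarrow> \<mu> \<le> 3 \<Longrightarrow> \<exists>g. has_pd \<mu> f g \<and> linspan X g"
    and m: "\<And>f j. X f \<Longrightarrow> linspan X (\<lambda>x. coord j x * f x)"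
  shows "rapid f"
proof -
  have d': "\<exists>g. has_pd \<mu> f g \<and> linspan X g" if "linspan X f" "\<mu> \<le> 3" for f \<mu>
    using that
  proof induction
    case (add f g)
    thus ?case by (blast intro: has_pd_add linspan.add)
  next
    case (scale f c)
    thus ?case by (blast intro: has_pd_cmult linspan.scale)
  qed (rule d)
  have cb: "continuous_on UNIV f \<and> bounded (range f)" if "linspan X f" for f
    using that
  proof induction
    case (add f g)
    thus ?case using bounded_plus_comp[of f UNIV g] by (auto intro!: continuous_intros)
  next
    case (scale f c)
    thus ?case using bounded_linear_image[OF _ bounded_linear_mult_right[of c], of "range f"]
      by (auto intro!: continuous_intros simp: image_image)
  qed (use c b in auto)
  show ?thesis using f
  proof (coinduction arbitrary: f)
    case rapid
    thus ?case
      using cb[OF rapid] d'[OF rapid] linspan_coord[OF rapid m] by (auto dest: pd_eqI)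
  qed
qed

lemma linspan_rapid: "linspan rapid f \<Longrightarrow> rapid f"
  by (rule rapid_coinduct_linspan)
    (blast intro: rapid_continuous rapid_bounded rapid_has_pd rapid_pd rapid_coord linspan.base)+

lemma rapid_add: "rapid f \<Longrightarrow> rapid g \<Longrightarrow> rapid (\<lambda>x. f x + g x)"
  and rapid_scale: "rapid f \<Longrightarrow> rapid (\<lambda>x. c * f x)"
  by (blast intro: linspan_rapid linspan.intros)+

lemma rapid_minus: "rapid f \<Longrightarrow> rapid (\<lambda>x. - f x)"
  using rapid_scale[of f "-1"] by simp

lemma rapid_zero: "rapid (\<lambda>x. 0)"
proof (coinduction)
  case rapid
  show ?case by (simp add: has_pd_const pd_eqI[OF has_pd_const])
qed

lemma rapid_sum: "(\<And>i. i \<in> I \<Longrightarrow> rapid (f i)) \<Longrightarrow> rapid (\<lambda>x. \<Sum>i\<in>I. f i x)"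
  by (induction I rule: infinite_finite_induct) (auto intro: rapid_add rapid_zero)

lemma rapid_mult:
  assumes "rapid f" "rapid g"
  shows "rapid (\<lambda>x. f x * g x)"
proof (rule rapid_coinduct_linspan[where X="\<lambda>h. \<exists>f g. rapid f \<and> rapid g \<and> h = (\<lambda>x. f x * g x)"])
  show "linspan (\<lambda>h. \<exists>f g. rapid f \<and> rapid g \<and> h = (\<lambda>x. f x * g x)) (\<lambda>x. f x * g x)"
    using assms by (blast intro: linspan.base)
next
  fix h assume "\<exists>f g. rapid f \<and> rapid g \<and> h = (\<lambda>x. f x * g x)"
  then obtain f g where f: "rapid f" and g: "rapid g" and h: "h = (\<lambda>x. f x * g x)" by blast
  show "continuous_on UNIV h"
    unfolding h by (intro continuous_intros rapid_continuous f g)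
  obtain a b where a: "\<And>x. norm (f x) \<le> a" and b: "\<And>x. norm (g x) \<le> b"
    using rapid_bounded[OF f] rapid_bounded[OF g] by (auto simp: bounded_iff)
  have "norm (h x) \<le> a * b" for x
    unfolding h norm_mult using a[of x] b[of x] order_trans[OF norm_ge_zero a[of x]] by (intro mult_mono) auto
  thus "bounded (range h)" unfolding bounded_iff by blast
  show "\<exists>h'. has_pd \<mu> h h' \<and> linspan (\<lambda>h. \<exists>f g. rapid f \<and> rapid g \<and> h = (\<lambda>x. f x * g x)) h'"
    if \<mu>: "\<mu> \<le> 3" for \<mu>
    unfolding h
  proof (rule exI, rule conjI)
    show "has_pd \<mu> (\<lambda>x. f x * g x) (\<lambda>x. f x * pd \<mu> g x + pd \<mu> f x * g x)"
      by (rule has_pd_mult[OF rapid_has_pd[OF f \<mu>] rapid_has_pd[OF g \<mu>]])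
    show "linspan (\<lambda>h. \<exists>f g. rapid f \<and> rapid g \<and> h = (\<lambda>x. f x * g x)) (\<lambda>x. f x * pd \<mu> g x + pd \<mu> f x * g x)"
      using f g rapid_pd[OF f \<mu>] rapid_pd[OF g \<mu>] by (intro linspan.add; intro linspan.base) blast+
  qed
  show "linspan (\<lambda>h. \<exists>f g. rapid f \<and> rapid g \<and> h = (\<lambda>x. f x * g x)) (\<lambda>x. coord j x * h x)" for j
    unfolding h
    by (intro linspan.base exI[of _ "\<lambda>x. coord j x * f x"] exI[of _ g] conjI rapid_coord f g) (auto simp: mult_ac)
qed

lemma rapid_reflect:
  assumes "rapid f"
  shows "rapid (\<lambda>x. f (fst x, - snd x))"
proof (rule rapid_coinduct_linspan[where X="\<lambda>h. \<exists>f. rapid f \<and> h = (\<lambda>x. f (fst x, - snd x))"])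
  show "linspan (\<lambda>h. \<exists>f. rapid f \<and> h = (\<lambda>x. f (fst x, - snd x))) (\<lambda>x. f (fst x, - snd x))"
    using assms by (blast intro: linspan.base)
next
  fix h :: "spacetime \<Rightarrow> complex" assume "\<exists>f. rapid f \<and> h = (\<lambda>x. f (fst x, - snd x))"
  then obtain f where f: "rapid f" and h: "h = (\<lambda>x. f (fst x, - snd x))" by blast
  show "continuous_on UNIV h"
    unfolding h by (intro continuous_on_compose2[OF rapid_continuous[OF f]] continuous_intros) auto
  show "bounded (range h)"
    by (rule bounded_subset[OF rapid_bounded[OF f]]) (auto simp: h)
  show "linspan (\<lambda>h. \<exists>f. rapid f \<and> h = (\<lambda>x. f (fst x, - snd x))) (\<lambda>x. coord j x * h x)" for j
    unfolding h
    by (intro linspan.base exI[of _ "\<lambda>x. - (coord j x * f x)"]) (use rapid_minus[OF rapid_coord[OF f, of j]] in \<open>simp add: coord_def\<close>)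
  fix \<mu> :: nat assume \<mu>: "\<mu> \<le> 3"
  define c where "c = (if \<mu> = 0 then 1 else - 1 :: real)"
  have e: "(fst (x + s *\<^sub>R basis_vec \<mu>), - snd (x + s *\<^sub>R basis_vec \<mu>)) = (fst x, - snd x) + (c * s) *\<^sub>R basis_vec \<mu>" for x s
    by (auto simp: c_def basis_vec_def)
  have "has_pd \<mu> h (\<lambda>x. complex_of_real c * pd \<mu> f (fst x, - snd x))"
    unfolding has_pd_def h e
  proof
    fix x :: spacetime
    have "((\<lambda>s. c * s) has_vector_derivative c) (at 0)" by (auto intro!: derivative_eq_intros)
    from vector_diff_chain_at[OF this, of "\<lambda>s. f ((fst x, - snd x) + s *\<^sub>R basis_vec \<mu>)" "pd \<mu> f (fst x, - snd x)"]
    show "((\<lambda>s. f ((fst x, - snd x) + (c * s) *\<^sub>R basis_vec \<mu>)) has_vector_derivative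
        complex_of_real c * pd \<mu> f (fst x, - snd x)) (at 0)"
      using rapid_has_pd[OF f \<mu>] by (simp add: has_pd_def o_def scaleR_conv_of_real)
  qed
  moreover have "linspan (\<lambda>h. \<exists>f. rapid f \<and> h = (\<lambda>x. f (fst x, - snd x))) (\<lambda>x. complex_of_real c * pd \<mu> f (fst x, - snd x))"
    by (intro linspan.scale linspan.base exI[of _ "pd \<mu> f"]) (simp add: rapid_pd f \<mu>)
  ultimately show "\<exists>g. has_pd \<mu> h g \<and> linspan (\<lambda>h. \<exists>f. rapid f \<and> h = (\<lambda>x. f (fst x, - snd x))) g"
    by blast
qed

definition jap_symbol :: "real \<Rightarrow> real ^ 3 \<Rightarrow> complex" where
  "jap_symbol s \<xi> = complex_of_real ((1 + (norm \<xi>)\<^sup>2) powr (s / 2))"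

lemma jap_symbol_add: "jap_symbol r \<xi> * jap_symbol s \<xi> = jap_symbol (r + s) \<xi>"
  by (simp add: jap_symbol_def powr_add[symmetric] add_divide_distrib flip: of_real_mult)

lemma has_pd_jap_symbol:
  "has_pd \<mu> (\<lambda>x. jap_symbol s (snd x))
     (\<lambda>x. complex_of_real (s * (snd x \<bullet> snd (basis_vec \<mu>))) * jap_symbol (s - 2) (snd x))"
  unfolding has_pd_def
proof
  fix x :: spacetime
  define e where "e = snd (basis_vec \<mu>)"
  have n: "(norm (snd x + r *\<^sub>R e))\<^sup>2 = (norm (snd x))\<^sup>2 + 2 * r * (snd x \<bullet> e) + r\<^sup>2 * (e \<bullet> e)" for r
    unfolding power2_norm_eq_inner
    by (simp add: inner_add_left inner_add_right inner_commute power2_eq_square algebra_simps)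
  have pos: "1 + (norm (snd x))\<^sup>2 > 0" by (simp add: add_pos_nonneg)
  have "((\<lambda>r. 1 + (norm (snd x + r *\<^sub>R e))\<^sup>2) has_real_derivative 2 * (snd x \<bullet> e)) (at 0)"
    unfolding n by (auto intro!: derivative_eq_intros)
  from DERIV_fun_powr[OF this, of "s / 2"] pos
  have "((\<lambda>r. (1 + (norm (snd x + r *\<^sub>R e))\<^sup>2) powr (s / 2)) has_real_derivative
      s / 2 * (1 + (norm (snd x))\<^sup>2) powr (s / 2 - 1) * (2 * (snd x \<bullet> e))) (at 0)"
    by simp
  moreover have "s / 2 - 1 = (s - 2) / 2" by simp
  ultimately have "((\<lambda>r. (1 + (norm (snd x + r *\<^sub>R e))\<^sup>2) powr (s / 2)) has_real_derivative
      s * (snd x \<bullet> e) * (1 + (norm (snd x))\<^sup>2) powr ((s - 2) / 2)) (at 0)"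
    by (simp add: mult_ac)
  from has_vector_derivative_of_real[OF this]
  show "((\<lambda>r. jap_symbol s (snd (x + r *\<^sub>R basis_vec \<mu>))) has_vector_derivative
      complex_of_real (s * (snd x \<bullet> snd (basis_vec \<mu>))) * jap_symbol (s - 2) (snd x)) (at 0)"
    by (simp add: jap_symbol_def e_def)
qed

lemma inner_snd_basis_vec: "snd x \<bullet> snd (basis_vec \<mu>) = (if \<mu> = 0 then 0 else snd x $ of_nat \<mu>)"
  by (simp add: basis_vec_def inner_axis)

text \<open>
The derivative of \<open>jap_symbol s\<close> in direction \<open>j\<close> is a multiple of coordinate \<open>j\<close> times \<open>jap_symbol (s - 2)\<close>, and the
coordinate is absorbed by \<open>f\<close>. The exponent must therefore vary in the coinduction; it stays
nonpositive, which keeps the symbol bounded.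
\<close>

lemma rapid_jap_symbol_mult:
  assumes "rapid f" and "s \<le> 0"
  shows "rapid (\<lambda>x. jap_symbol s (snd x) * f x)"
proof (rule rapid_coinduct_linspan[where X="\<lambda>h. \<exists>s f. s \<le> 0 \<and> rapid f \<and> h = (\<lambda>x. jap_symbol s (snd x) * f x)"])
  show "linspan (\<lambda>h. \<exists>s f. s \<le> 0 \<and> rapid f \<and> h = (\<lambda>x. jap_symbol s (snd x) * f x)) (\<lambda>x. jap_symbol s (snd x) * f x)"
    using assms by (blast intro: linspan.base)
next
  fix h :: "spacetime \<Rightarrow> complex" assume "\<exists>s f. s \<le> 0 \<and> rapid f \<and> h = (\<lambda>x. jap_symbol s (snd x) * f x)"
  then obtain s f where s: "s \<le> 0" and f: "rapid f" and h: "h = (\<lambda>x. jap_symbol s (snd x) * f x)" by blast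
  have pos: "1 + (norm (snd x))\<^sup>2 > 0" for x :: spacetime by (simp add: add_pos_nonneg)
  show "continuous_on UNIV h"
    unfolding h jap_symbol_def using pos by (intro continuous_intros rapid_continuous f) (auto simp: less_imp_neq[symmetric])
  obtain a where a: "\<And>x. norm (f x) \<le> a" using rapid_bounded[OF f] by (auto simp: bounded_iff)
  have "norm (h x) \<le> a" for x
  proof -
    have "norm (jap_symbol s (snd x)) \<le> 1"
      using s powr_mono[of "s / 2" 0 "1 + (norm (snd x))\<^sup>2"] pos[of x] by (simp add: jap_symbol_def)
    thus ?thesis using a[of x] by (auto simp: h norm_mult intro: order_trans[OF mult_left_le_one_le])
  qed
  thus "bounded (range h)" unfolding bounded_iff by blast
  show "linspan (\<lambda>h. \<exists>s f. s \<le> 0 \<and> rapid f \<and> h = (\<lambda>x. jap_symbol s (snd x) * f x)) (\<lambda>x. coord j x * h x)" for j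
    unfolding h using s f by (intro linspan.base exI[of _ s] exI[of _ "\<lambda>x. coord j x * f x"] conjI rapid_coord) (auto simp: mult_ac)
  fix \<mu> :: nat assume \<mu>: "\<mu> \<le> 3"
  let ?g = "\<lambda>x. jap_symbol s (snd x) * pd \<mu> f x + complex_of_real (s * (snd x \<bullet> snd (basis_vec \<mu>))) * jap_symbol (s - 2) (snd x) * f x"
  let ?g' = "\<lambda>x. jap_symbol s (snd x) * pd \<mu> f x +
      (if \<mu> = 0 then 0 else complex_of_real s) * (jap_symbol (s - 2) (snd x) * (coord (of_nat \<mu>) x * f x))"
  have E: "?g = ?g'"
    by (auto simp: inner_snd_basis_vec coord_def)
  have "has_pd \<mu> h ?g"
    unfolding h by (rule has_pd_mult[OF has_pd_jap_symbol rapid_has_pd[OF f \<mu>]])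
  hence "has_pd \<mu> h ?g'" unfolding E .
  moreover have "linspan (\<lambda>h. \<exists>s f. s \<le> 0 \<and> rapid f \<and> h = (\<lambda>x. jap_symbol s (snd x) * f x)) ?g'"
  proof (intro linspan.add linspan.scale; intro linspan.base exI conjI)
    show "s \<le> 0" "s - 2 \<le> 0" using s by auto
    show "rapid (pd \<mu> f)" "rapid (\<lambda>x. coord (of_nat \<mu>) x * f x)" by (intro rapid_pd rapid_coord f \<mu>)+
  qed (rule refl)+
  ultimately show "\<exists>g. has_pd \<mu> h g \<and> linspan (\<lambda>h. \<exists>s f. s \<le> 0 \<and> rapid f \<and> h = (\<lambda>x. jap_symbol s (snd x) * f x)) g"
    by (intro exI conjI)
qed

text \<open>
The factor \<open>1 / weight\<close> is a polynomial in the coordinates, so \<open>f / weight\<close> is rapid, hence bounded.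
The constant does not depend on time.
\<close>

lemma rapid_weight_bound:
  assumes "rapid f"
  obtains C where "\<And>t y. norm (f (t, y)) \<le> C * weight y"
proof -
  have "rapid (\<lambda>x. (\<Prod>j\<in>J. 1 + (coord j x)\<^sup>2) * f x)" for J
  proof (induction J rule: infinite_finite_induct)
    case (insert j J)
    have "rapid (\<lambda>x. (\<Prod>j\<in>J. 1 + (coord j x)\<^sup>2) * f x + coord j x * (coord j x * ((\<Prod>j\<in>J. 1 + (coord j x)\<^sup>2) * f x)))"
      by (intro rapid_add rapid_coord insert.IH)
    with insert.hyps show ?case by (simp add: algebra_simps power2_eq_square)
  qed (use assms in auto)
  from rapid_bounded[OF this[of UNIV]] obtain C where
    C: "\<And>x. norm ((\<Prod>j\<in>UNIV. 1 + (coord j x)\<^sup>2) * f x) \<le> C" by (auto simp: bounded_iff)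
  have "norm (f (t, y)) \<le> C * weight y" for t y
  proof -
    have w: "weight y = (\<Prod>j\<in>UNIV. 1 / (1 + (y $ j)\<^sup>2))"
      unfolding weight_def Basis_vec_def
      by (subst prod.reindex_bij_betw[of "\<lambda>j. axis j (1::real)" UNIV, symmetric])
         (auto simp: bij_betw_def inj_on_def axis_eq_axis inner_axis)
    have P: "(\<Prod>j\<in>UNIV. 1 + (coord j (t, y))\<^sup>2) = complex_of_real (1 / weight y)"
      by (simp add: w prod_dividef coord_def)
    show ?thesis using C[of "(t, y)", unfolded P] weight_pos[of y] by (simp add: norm_mult norm_divide field_simps)
  qed
  thus ?thesis by (rule that)
qed

lemma schwartz_differentiable: "schwartz w \<Longrightarrow> w differentiable (at x)"
  and schwartz_bound: "schwartz w \<Longrightarrow> \<exists>C. \<forall>x. norm x ^ k * norm (w x) \<le> C"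
  unfolding schwartz_def by (drule spec[of _ "[]"], simp)+

lemma schwartz_pd:
  assumes "schwartz w" "\<mu> \<le> 3" shows "schwartz (pd \<mu> w)"
  unfolding schwartz_def
proof (intro allI impI)
  fix \<mu>s assume "set \<mu>s \<subseteq> {0..3::nat}"
  with assms(2) have "set (\<mu>s @ [\<mu>]) \<subseteq> {0..3}" by auto
  moreover have "foldr pd (\<mu>s @ [\<mu>]) w = foldr pd \<mu>s (pd \<mu> w)" by simp
  ultimately show "(\<forall>x. foldr pd \<mu>s (pd \<mu> w) differentiable (at x)) \<and>
      (\<forall>k. \<exists>C. \<forall>x. norm x ^ k * norm (foldr pd \<mu>s (pd \<mu> w) x) \<le> C)"
    using assms(1) unfolding schwartz_def by metis
qed

lemma schwartz_has_pd:
  assumes "schwartz w" shows "has_pd \<mu> w (pd \<mu> w)"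
  unfolding has_pd_def pd_def
proof
  fix x
  have "(w \<circ> (\<lambda>s. x + s *\<^sub>R basis_vec \<mu>)) differentiable (at 0)"
    using schwartz_differentiable[OF assms] by (intro differentiable_chain_at) auto
  thus "((\<lambda>s. w (x + s *\<^sub>R basis_vec \<mu>)) has_vector_derivative
      vector_derivative (\<lambda>s. w (x + s *\<^sub>R basis_vec \<mu>)) (at 0)) (at 0)"
    by (simp add: o_def vector_derivative_works)
qed

lemma bounded_linear_matrix_entry: "bounded_linear (\<lambda>M::complex^'n^'m. M $ a $ b)"
  by (rule bounded_linear_compose[OF bounded_linear_vec_nth bounded_linear_vec_nth])

text \<open>
The candidate class consists of the monomials in the coordinates times an entry of a Schwartz field;
the powers of the norm in \<open>schwartz\<close> control the monomials.
\<close>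

lemma schwartz_imp_rapid:
  fixes u :: "'n::finite field"
  assumes "schwartz u" shows "rapid (\<lambda>x. u x $ a $ b)"
proof -
  define X where "X h \<longleftrightarrow> (\<exists>js (w::'n field). schwartz w \<and> h = (\<lambda>x. (\<Prod>j\<leftarrow>js. coord j x) * w x $ a $ b))" for h
  have Xc: "X (\<lambda>x. coord j x * h x)" if Xh: "X h" for j h
  proof -
    obtain js w where "schwartz w" "h = (\<lambda>x. (\<Prod>j\<leftarrow>js. coord j x) * w x $ a $ b)"
      using Xh unfolding X_def by blast
    thus ?thesis unfolding X_def by (intro exI[of _ "j # js"] exI[of _ w]) (simp add: mult_ac)
  qed
  show ?thesis
  proof (rule rapid_coinduct_linspan[where X=X])
    show "linspan X (\<lambda>x. u x $ a $ b)"
      unfolding X_def using assms by (intro linspan.base exI[of _ "[]"] exI[of _ u]) simp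
  next
    fix h assume "X h"
    then obtain js w where w: "schwartz w" and h: "h = (\<lambda>x. (\<Prod>j\<leftarrow>js. coord j x) * w x $ a $ b)"
      unfolding X_def by blast
    have "continuous_on UNIV (\<lambda>x. \<Prod>j\<leftarrow>js. coord j x)"
      by (induction js) (auto intro!: continuous_intros continuous_coord)
    moreover have "continuous_on UNIV w"
      using schwartz_differentiable[OF w] by (auto intro!: differentiable_imp_continuous_on simp: differentiable_on_def intro: differentiable_at_withinI)
    ultimately show "continuous_on UNIV h"
      unfolding h by (intro continuous_intros)
    obtain C where C: "\<And>x. norm x ^ length js * norm (w x) \<le> C" using schwartz_bound[OF w] by blast
    have p: "norm (\<Prod>j\<leftarrow>js. coord j x) \<le> norm x ^ length js" for x
    proof (induction js)
      case (Cons j js)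
      have "norm (coord j x) \<le> norm x"
        using component_le_norm_cart[of "snd x" j] norm_snd_le[of "snd x" "fst x"] by (simp add: coord_def)
      with Cons show ?case by (auto simp: norm_mult intro!: mult_mono)
    qed simp
    have "norm (h x) \<le> C" for x
    proof -
      have "norm (w x $ a $ b) \<le> norm (w x)"
        using Finite_Cartesian_Product.norm_nth_le[where x="w x" and i=a] Finite_Cartesian_Product.norm_nth_le[where x="w x $ a" and i=b] by linarith
      hence "norm (h x) \<le> norm x ^ length js * norm (w x)"
        using p[of x] by (auto simp: h norm_mult intro!: mult_mono)
      thus ?thesis using C[of x] by simp
    qed
    thus "bounded (range h)" unfolding bounded_iff by blast
    fix \<mu> :: nat assume \<mu>: "\<mu> \<le> 3"
    show "\<exists>g. has_pd \<mu> h g \<and> linspan X g"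
      unfolding h
    proof (induction js)
      case Nil
      have "linspan X (\<lambda>x. pd \<mu> w x $ a $ b)"
        unfolding X_def using schwartz_pd[OF w \<mu>] by (intro linspan.base exI[of _ "[]"] exI[of _ "pd \<mu> w"]) simp
      thus ?case using has_pd_linear[OF bounded_linear_matrix_entry schwartz_has_pd[OF w]] by auto
    next
      case (Cons j js)
      then obtain g where g: "has_pd \<mu> (\<lambda>x. (\<Prod>j\<leftarrow>js. coord j x) * w x $ a $ b) g" "linspan X g" by blast
      have "X (\<lambda>x. (\<Prod>j\<leftarrow>js. coord j x) * w x $ a $ b)" unfolding X_def using w by blast
      hence L: "linspan X (\<lambda>x. coord j x * g x + complex_of_real (snd (basis_vec \<mu>) $ j) * ((\<Prod>j\<leftarrow>js. coord j x) * w x $ a $ b))"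
        by (intro linspan.add linspan.scale linspan_coord[OF g(2)]) (blast intro: linspan.base Xc)+
      have E: "(\<lambda>x. (\<Prod>j\<leftarrow>j # js. coord j x) * w x $ a $ b) =
          (\<lambda>x. coord j x * ((\<Prod>j\<leftarrow>js. coord j x) * w x $ a $ b))" by (simp only: list.map prod_list.Cons mult.assoc)
      show ?case
        unfolding E by (rule exI, rule conjI, rule has_pd_mult[OF has_pd_coord g(1)], rule L)
    qed
  next
    show "linspan X (\<lambda>x. coord j x * h x)" if "X h" for h j
      using Xc[OF that] by (rule linspan.base)
  qed
qed

section \<open>The Fourier transform in space\<close>

definition fourier_space :: "(spacetime \<Rightarrow> complex) \<Rightarrow> spacetime \<Rightarrow> complex" where
  "fourier_space f x = fourier (\<lambda>y. f (fst x, y)) (snd x)"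

definition inv_fourier_space :: "(spacetime \<Rightarrow> complex) \<Rightarrow> spacetime \<Rightarrow> complex" where
  "inv_fourier_space f x = inv_fourier (\<lambda>\<xi>. f (fst x, \<xi>)) (snd x)"

lemma continuous_slice: "rapid f \<Longrightarrow> continuous_on S g \<Longrightarrow> continuous_on S h \<Longrightarrow> continuous_on S (\<lambda>y. f (g y, h y))"
  by (rule continuous_on_compose2[OF rapid_continuous]) (auto intro!: continuous_intros)

lemma integrable_unimodular_rapid:
  assumes f: "rapid f"
  shows "integrable lborel (\<lambda>y::real^3. cis (- (y \<bullet> \<xi>)) * f (t, y))"
proof -
  obtain C where C: "\<And>t y. norm (f (t, y)) \<le> C * weight y" using rapid_weight_bound[OF f] by blast
  show ?thesis
  proof (rule Bochner_Integration.integrable_bound)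
    show "integrable lborel (\<lambda>y::real^3. C * weight y)" by (simp add: integrable_weight)
    show "(\<lambda>y::real^3. cis (- (y \<bullet> \<xi>)) * f (t, y)) \<in> borel_measurable lborel"
      by (simp, intro borel_measurable_continuous_onI continuous_intros continuous_slice f)
    show "AE y::real^3 in lborel. norm (cis (- (y \<bullet> \<xi>)) * f (t, y)) \<le> norm (C * weight y)"
      using C by (intro AE_I2) (simp add: norm_mult, meson abs_ge_self order_trans)
  qed
qed

lemma integrable_rapid: "rapid f \<Longrightarrow> integrable lborel (\<lambda>y. f (t, y))"
  using integrable_unimodular_rapid[of f 0 t] by simp

lemma fourier_space_scale: "fourier_space (\<lambda>x. c * f x) x = c * fourier_space f x"
  by (simp add: fourier_space_def fourier_def mult.left_commute[of _ c])

lemma fourier_space_add: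
  "rapid f \<Longrightarrow> rapid g \<Longrightarrow> fourier_space (\<lambda>x. f x + g x) x = fourier_space f x + fourier_space g x"
  by (simp add: fourier_space_def fourier_def distrib_left integrable_unimodular_rapid)

lemma continuous_fourier_space:
  assumes f: "rapid f" shows "continuous_on UNIV (fourier_space f)"
proof -
  obtain C where C: "\<And>t y. norm (f (t, y)) \<le> C * weight y" using rapid_weight_bound[OF f] by blast
  show ?thesis
    unfolding continuous_on_sequentially o_def
  proof (intro allI ballI impI)
    fix x and X :: "nat \<Rightarrow> spacetime" assume X: "(\<forall>n. X n \<in> UNIV) \<and> X \<longlonglongrightarrow> x"
    show "(\<lambda>n. fourier_space f (X n)) \<longlonglongrightarrow> fourier_space f x"
      unfolding fourier_space_def fourier_def
    proof (rule integral_dominated_convergence)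
      show "integrable lborel (\<lambda>y::real^3. C * weight y)" by (simp add: integrable_weight)
      show "AE y in lborel. (\<lambda>n. cis (- (y \<bullet> snd (X n))) * f (fst (X n), y)) \<longlonglongrightarrow> cis (- (y \<bullet> snd x)) * f (fst x, y)"
      proof (rule AE_I2)
        fix y :: "real ^ 3"
        have "continuous_on UNIV (\<lambda>x. cis (- (y \<bullet> snd x)) * f (fst x, y))"
          by (intro continuous_intros continuous_slice f)
        thus "(\<lambda>n. cis (- (y \<bullet> snd (X n))) * f (fst (X n), y)) \<longlonglongrightarrow> cis (- (y \<bullet> snd x)) * f (fst x, y)"
          using X unfolding continuous_on_sequentially o_def by blast
      qed
      show "AE y in lborel. norm (cis (- (y \<bullet> snd (X n))) * f (fst (X n), y)) \<le> C * weight y" for n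
        using C by (intro AE_I2) (simp add: norm_mult)
    qed (simp_all, (intro borel_measurable_continuous_onI continuous_intros continuous_slice f)+)
  qed
qed

lemma bounded_fourier_space:
  assumes f: "rapid f" shows "bounded (range (fourier_space f))"
proof -
  obtain C where C: "\<And>t y. norm (f (t, y)) \<le> C * weight y" using rapid_weight_bound[OF f] by blast
  have "norm (fourier_space f x) \<le> (LINT y::real^3|lborel. C * weight y)" for x
    unfolding fourier_space_def fourier_def
    by (intro Bochner_Integration.integral_norm_bound_integral integrable_unimodular_rapid f)
       (use C in \<open>auto simp: norm_mult integrable_weight\<close>)
  thus ?thesis unfolding bounded_iff by blast
qed

lemma weight_shift:
  fixes y v :: "'a::euclidean_space"
  assumes v: "norm v \<le> 1" shows "weight (y + v) \<le> 3 ^ DIM('a) * weight y"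
proof -
  have "weight (y + v) \<le> (\<Prod>b\<in>Basis. 3 * (1 / (1 + (y \<bullet> b)\<^sup>2)))"
    unfolding weight_def
  proof (intro prod_mono conjI)
    fix b :: 'a assume b: "b \<in> Basis"
    define a c where "a = y \<bullet> b" and "c = v \<bullet> b"
    have c: "c\<^sup>2 \<le> 1" using Basis_le_norm[OF b, of v] v by (simp add: c_def abs_le_square_iff[symmetric] power2_eq_1_iff abs_square_le_1)
    have "a\<^sup>2 = ((a + c) - c)\<^sup>2" by simp
    also have "\<dots> \<le> 2 * (a + c)\<^sup>2 + 2 * c\<^sup>2"
      using zero_le_power2[of "(a + c) + c"] by (simp add: power2_eq_square algebra_simps)
    finally have "1 + a\<^sup>2 \<le> 3 * (1 + (a + c)\<^sup>2)" using c zero_le_power2[of "a + c"] by (smt (verit))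
    moreover have "1 + (a + c)\<^sup>2 > 0" "1 + a\<^sup>2 > 0" by (simp_all add: add_pos_nonneg)
    ultimately show "1 / (1 + ((y + v) \<bullet> b)\<^sup>2) \<le> 3 * (1 / (1 + (y \<bullet> b)\<^sup>2))"
      by (simp add: inner_add_left field_simps flip: a_def c_def)
  qed (simp add: add_pos_nonneg)
  also have "\<dots> = 3 ^ DIM('a) * weight y"
    by (simp only: weight_def prod.distrib prod_constant)
  finally show ?thesis .
qed

lemma has_pd_fourier_space_time:
  assumes f: "rapid f" shows "has_pd 0 (fourier_space f) (fourier_space (pd 0 f))"
  unfolding has_pd_def
proof
  fix x :: spacetime
  obtain t \<xi> where x: "x = (t, \<xi>)" by (cases x)
  obtain C where C: "\<And>t y. norm (pd 0 f (t, y)) \<le> C * weight y"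
    using rapid_weight_bound[OF rapid_pd[OF f, of 0]] by auto
  have "((\<lambda>s. LINT y|lborel. cis (- (y \<bullet> \<xi>)) * f (t + s, y)) has_vector_derivative
      (LINT y|lborel. cis (- (y \<bullet> \<xi>)) * pd 0 f (t + 0, y))) (at 0)"
  proof (rule has_vector_derivative_integral)
    show "((\<lambda>s. cis (- (y \<bullet> \<xi>)) * f (t + s, y)) has_vector_derivative cis (- (y \<bullet> \<xi>)) * pd 0 f (t + s, y)) (at s)" for s y
      using has_pd_at[OF rapid_has_pd[OF f, of 0], of "(t, y)" s]
      by (intro has_vector_derivative_mult_right) (simp add: basis_vec_def)
    show "norm (cis (- (y \<bullet> \<xi>)) * pd 0 f (t + s, y)) \<le> C * weight y" for s y
      using C by (simp add: norm_mult)
    show "integrable lborel (\<lambda>y::real^3. C * weight y)" by (simp add: integrable_weight)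
  qed (rule integrable_unimodular_rapid[OF f])
  thus "((\<lambda>s. fourier_space f (x + s *\<^sub>R basis_vec 0)) has_vector_derivative fourier_space (pd 0 f) x) (at 0)"
    by (simp add: x fourier_space_def fourier_def basis_vec_def)
qed

text \<open>
The factor \<open>coord\<close> produced by differentiating the exponential is harmless: \<open>coord j * f\<close> is again rapid
and hence dominated by a multiple of \<open>weight\<close>.
\<close>

lemma has_pd_fourier_space_space:
  assumes f: "rapid f" and \<mu>: "\<mu> \<noteq> 0"
  shows "has_pd \<mu> (fourier_space f) (fourier_space (\<lambda>x. - \<i> * (coord (of_nat \<mu>) x * f x)))"
  unfolding has_pd_def
proof
  fix x :: spacetime
  obtain t \<xi> where x: "x = (t, \<xi>)" by (cases x)
  define j :: 3 where "j = of_nat \<mu>"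
  define e :: "real ^ 3" where "e = axis j 1"
  have r: "rapid (\<lambda>x. coord j x * f x)" using f by (rule rapid_coord)
  obtain C where C: "\<And>t y. norm (coord j (t, y) * f (t, y)) \<le> C * weight y"
    using rapid_weight_bound[OF r] by auto
  have "((\<lambda>s. LINT y|lborel. cis (- (y \<bullet> (\<xi> + s *\<^sub>R e))) * f (t, y)) has_vector_derivative
      (LINT y|lborel. cis (- (y \<bullet> (\<xi> + 0 *\<^sub>R e))) * (- \<i> * (coord j (t, y) * f (t, y))))) (at 0)"
  proof (rule has_vector_derivative_integral)
    fix s :: real and y :: "real ^ 3"
    have "((\<lambda>s. cis (- (y \<bullet> \<xi>) - s * (y $ j))) has_vector_derivative
        (- (y $ j)) *\<^sub>R (\<i> * cis (- (y \<bullet> \<xi>) - s * (y $ j)))) (at s)"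
    proof -
      have "((\<lambda>s. - (y \<bullet> \<xi>) - s * (y $ j)) has_vector_derivative (- (y $ j))) (at s)"
        by (auto intro!: derivative_eq_intros)
      moreover have "(cis has_vector_derivative \<i> * cis u) (at u)" for u
        unfolding has_vector_derivative_def
        by (rule has_derivative_eq_rhs[OF has_derivative_cis[OF has_derivative_ident]])
           (auto simp: scaleR_conv_of_real)
      ultimately have "(cis \<circ> (\<lambda>s. - (y \<bullet> \<xi>) - s * (y $ j)) has_vector_derivative
          (- (y $ j)) *\<^sub>R (\<i> * cis (- (y \<bullet> \<xi>) - s * (y $ j)))) (at s)"
        by (rule vector_diff_chain_at)
      thus ?thesis by (simp only: o_def)
    qed
    hence "((\<lambda>s. cis (- (y \<bullet> \<xi>) - s * (y $ j)) * f (t, y)) has_vector_derivative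
        (- (y $ j)) *\<^sub>R (\<i> * cis (- (y \<bullet> \<xi>) - s * (y $ j))) * f (t, y)) (at s)"
      by (rule has_vector_derivative_mult_left)
    moreover have i: "- (y \<bullet> (\<xi> + s *\<^sub>R e)) = - (y \<bullet> \<xi>) - s * (y $ j)" for s
      by (simp add: e_def inner_add_right inner_axis)
    ultimately show "((\<lambda>s. cis (- (y \<bullet> (\<xi> + s *\<^sub>R e))) * f (t, y)) has_vector_derivative
        cis (- (y \<bullet> (\<xi> + s *\<^sub>R e))) * (- \<i> * (coord j (t, y) * f (t, y)))) (at s)"
      unfolding i by (simp add: coord_def scaleR_conv_of_real mult_ac)
    show "norm (cis (- (y \<bullet> (\<xi> + s *\<^sub>R e))) * (- \<i> * (coord j (t, y) * f (t, y)))) \<le> C * weight y"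
      using C[of t y] by (simp add: norm_mult)
  next
    show "integrable lborel (\<lambda>y::real^3. C * weight y)" by (simp add: integrable_weight)
  qed (rule integrable_unimodular_rapid[OF f])
  thus "((\<lambda>s. fourier_space f (x + s *\<^sub>R basis_vec \<mu>)) has_vector_derivative
      fourier_space (\<lambda>x. - \<i> * (coord (of_nat \<mu>) x * f x)) x) (at 0)"
    using \<mu> by (simp add: x fourier_space_def fourier_def basis_vec_def j_def e_def)
qed

text \<open>
No integration by parts: translating \<open>f\<close> by \<open>s\<close> along an axis multiplies its transform by
\<open>cis (s * \<xi> $ j)\<close>, and the claim is the derivative of this identity at \<open>s = 0\<close>, taken under the
integral on one side.
\<close>

lemma fourier_space_pd_space:
  assumes f: "rapid f" and \<mu>: "\<mu> \<noteq> 0" "\<mu> \<le> 3"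
  shows "fourier_space (pd \<mu> f) x = \<i> * (coord (of_nat \<mu>) x * fourier_space f x)"
proof -
  obtain t \<xi> where x: "x = (t, \<xi>)" by (cases x)
  define j :: 3 where "j = of_nat \<mu>"
  define e :: "real ^ 3" where "e = axis j 1"
  obtain C where C: "\<And>t y. norm (pd \<mu> f (t, y)) \<le> C * weight y"
    using rapid_weight_bound[OF rapid_pd[OF f \<mu>(2)]] by auto
  have C0: "C \<ge> 0"
    using order_trans[OF norm_ge_zero C[of t 0]] weight_pos[of "0 :: real^3"] by (simp add: zero_le_mult_iff)
  have shift: "(\<lambda>y. cis (- (y \<bullet> \<xi>)) * f (t, y + s *\<^sub>R e)) =
      (\<lambda>y. (\<lambda>y. cis (s * \<xi> $ j) * (cis (- (y \<bullet> \<xi>)) * f (t, y))) (s *\<^sub>R e + 1 *\<^sub>R y))" for s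
  proof
    fix y
    have "cis (s * \<xi> $ j) * cis (- ((s *\<^sub>R e + 1 *\<^sub>R y) \<bullet> \<xi>)) = cis (- (y \<bullet> \<xi>))"
      unfolding cis_mult by (simp add: inner_add_left e_def inner_axis')
    thus "cis (- (y \<bullet> \<xi>)) * f (t, y + s *\<^sub>R e) =
        (\<lambda>y. cis (s * \<xi> $ j) * (cis (- (y \<bullet> \<xi>)) * f (t, y))) (s *\<^sub>R e + 1 *\<^sub>R y)"
      by (simp only: mult.assoc[symmetric] add.commute[of y] scaleR_one)
  qed
  have m: "(\<lambda>y. cis (s * \<xi> $ j) * (cis (- (y \<bullet> \<xi>)) * f (t, y))) \<in> borel_measurable borel" for s
    by (intro borel_measurable_continuous_onI continuous_intros continuous_slice f)
  have int: "integrable lborel (\<lambda>y. cis (- (y \<bullet> \<xi>)) * f (t, y + s *\<^sub>R e))" for s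
    unfolding shift by (subst integrable_lborel_affine_iff[OF _ m]) (auto intro!: integrable_unimodular_rapid f)
  have eq: "(LINT y|lborel. cis (- (y \<bullet> \<xi>)) * f (t, y + s *\<^sub>R e)) = cis (s * \<xi> $ j) * fourier_space f x" for s
    unfolding shift using integral_lborel_affine[OF _ m, of 1 s "s *\<^sub>R e"]
    by (simp add: x fourier_space_def fourier_def)
  have "((\<lambda>s. LINT y|lborel. cis (- (y \<bullet> \<xi>)) * f (t, y + s *\<^sub>R e)) has_vector_derivative
      (LINT y|lborel. cis (- (y \<bullet> \<xi>)) * pd \<mu> f (t, y + 0 *\<^sub>R e))) (at 0)"
  proof (rule has_vector_derivative_integral)
    show "((\<lambda>s. cis (- (y \<bullet> \<xi>)) * f (t, y + s *\<^sub>R e)) has_vector_derivative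
        cis (- (y \<bullet> \<xi>)) * pd \<mu> f (t, y + s *\<^sub>R e)) (at s)" for s y
      using has_pd_at[OF rapid_has_pd[OF f \<mu>(2)], of "(t, y)" s] \<mu>
      by (intro has_vector_derivative_mult_right) (simp add: basis_vec_def e_def j_def)
    show "norm (cis (- (y \<bullet> \<xi>)) * pd \<mu> f (t, y + s *\<^sub>R e)) \<le> C * (27 * weight y)" if "\<bar>s\<bar> \<le> 1" for s y
    proof -
      have "weight (y + s *\<^sub>R e) \<le> 27 * weight y"
        using weight_shift[of "s *\<^sub>R e" y] that by (simp add: e_def)
      hence "C * weight (y + s *\<^sub>R e) \<le> C * (27 * weight y)" using C0 by (rule mult_left_mono)
      thus ?thesis using C[of t "y + s *\<^sub>R e"] by (simp add: norm_mult)
    qed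
    show "integrable lborel (\<lambda>y::real^3. C * (27 * weight y))" by (simp add: integrable_weight)
  qed (rule int)
  hence "((\<lambda>s. cis (s * \<xi> $ j) * fourier_space f x) has_vector_derivative fourier_space (pd \<mu> f) x) (at 0)"
    unfolding eq by (simp add: x fourier_space_def fourier_def)
  moreover have "((\<lambda>s. cis (s * \<xi> $ j) * fourier_space f x) has_vector_derivative (\<i> * \<xi> $ j) * fourier_space f x) (at 0)"
  proof (rule has_vector_derivative_mult_left)
    show "((\<lambda>s. cis (s * \<xi> $ j)) has_vector_derivative (\<i> * \<xi> $ j)) (at 0)"
      unfolding has_vector_derivative_def
      by (rule has_derivative_eq_rhs[OF has_derivative_cis[OF has_derivative_mult_left[OF has_derivative_ident]]])
         (auto simp: scaleR_conv_of_real)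
  qed
  ultimately have "fourier_space (pd \<mu> f) x = (\<i> * \<xi> $ j) * fourier_space f x"
    by (rule vector_derivative_unique_at)
  thus ?thesis by (simp add: x coord_def j_def)
qed

lemma ex_space_index: "\<exists>\<mu>. \<mu> \<noteq> 0 \<and> \<mu> \<le> 3 \<and> of_nat \<mu> = (j :: 3)"
proof -
  consider "j = 1" | "j = 2" | "j = 3" using exhaust_3 by blast
  thus ?thesis
  proof cases
    case 1 thus ?thesis by (intro exI[of _ 1]) simp
  next
    case 2 thus ?thesis by (intro exI[of _ 2]) simp
  next
    case 3 thus ?thesis by (intro exI[of _ 3]) simp
  qed
qed

text \<open>
The transform exchanges derivatives and coordinates, so the defining closure properties of rapid
functions pass from \<open>f\<close> to its transform.
\<close>

lemma rapid_fourier_space: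
  assumes "rapid f" shows "rapid (fourier_space f)"
proof (rule rapid_coinduct_linspan[where X="\<lambda>h. \<exists>f. rapid f \<and> h = fourier_space f"])
  show "linspan (\<lambda>h. \<exists>f. rapid f \<and> h = fourier_space f) (fourier_space f)"
    using assms by (blast intro: linspan.base)
next
  fix h assume "\<exists>f. rapid f \<and> h = fourier_space f"
  then obtain f where f: "rapid f" and h: "h = fourier_space f" by blast
  show "continuous_on UNIV h" "bounded (range h)"
    unfolding h by (intro continuous_fourier_space bounded_fourier_space f)+
  show "\<exists>g. has_pd \<mu> h g \<and> linspan (\<lambda>h. \<exists>f. rapid f \<and> h = fourier_space f) g" if "\<mu> \<le> 3" for \<mu>
  proof (cases "\<mu> = 0")
    case True
    thus ?thesis
      unfolding h using has_pd_fourier_space_time[OF f] rapid_pd[OF f, of 0] by (blast intro: linspan.base)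
  next
    case False
    show ?thesis
      unfolding h
      using has_pd_fourier_space_space[OF f False] rapid_scale[OF rapid_coord[OF f, of "of_nat \<mu>"], of "- \<i>"]
      by (blast intro: linspan.base)
  qed
  show "linspan (\<lambda>h. \<exists>f. rapid f \<and> h = fourier_space f) (\<lambda>x. coord j x * h x)" for j
  proof -
    obtain \<mu> where \<mu>: "\<mu> \<noteq> 0" "\<mu> \<le> 3" "of_nat \<mu> = j" using ex_space_index by blast
    have "(\<lambda>x. coord j x * h x) = (\<lambda>x. - \<i> * fourier_space (pd \<mu> f) x)"
      by (simp add: h fourier_space_pd_space[OF f \<mu>(1,2)] \<mu>(3) mult.assoc[symmetric])
    moreover have "linspan (\<lambda>h. \<exists>f. rapid f \<and> h = fourier_space f) (\<lambda>x. - \<i> * fourier_space (pd \<mu> f) x)"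
      using rapid_pd[OF f \<mu>(2)] by (intro linspan.scale linspan.base) blast
    ultimately show ?thesis by (simp only:)
  qed
qed

lemma inv_fourier_space_fourier_space:
  assumes f: "rapid f" shows "inv_fourier_space (fourier_space f) x = f x"
proof -
  obtain t y where x: "x = (t, y)" by (cases x)
  obtain B where B: "\<And>x. norm (f x) \<le> B" using rapid_bounded[OF f] by (auto simp: bounded_iff)
  have "integrable lborel (fourier (\<lambda>y. f (t, y)))"
    using integrable_rapid[OF rapid_fourier_space[OF f], of t] by (simp add: fourier_space_def)
  hence "inv_fourier (fourier (\<lambda>y. f (t, y))) y = f (t, y)"
    by (intro fourier_inversion[where B=B] B integrable_rapid f continuous_slice continuous_intros) 
  thus ?thesis by (simp add: x inv_fourier_space_def fourier_space_def)
qed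

lemma fourier_space_inj: "rapid f \<Longrightarrow> rapid g \<Longrightarrow> (\<And>x. fourier_space f x = fourier_space g x) \<Longrightarrow> f = g"
  by (metis ext inv_fourier_space_fourier_space)

lemma inv_fourier_space_reflect:
  "inv_fourier_space f x = complex_of_real (1 / (2 * pi) ^ 3) * fourier_space f (fst x, - snd x)"
  by (simp add: inv_fourier_space_def inv_fourier_def fourier_space_def fourier_def inner_commute)

lemma rapid_inv_fourier_space: "rapid f \<Longrightarrow> rapid (inv_fourier_space f)"
  unfolding inv_fourier_space_reflect[abs_def]
  by (intro rapid_scale rapid_reflect rapid_fourier_space)

text \<open>
Up to a reflection and a constant the inverse transform is the transform itself, so this is the
other inversion formula with the integration variable reflected.
\<close>

lemma fourier_space_inv_fourier_space:
  assumes f: "rapid f" shows "fourier_space (inv_fourier_space f) x = f x"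
proof -
  let ?g = "\<lambda>y. cis (- (y \<bullet> snd x)) * fourier_space f (fst x, - y)"
  have m: "?g \<in> borel_measurable borel"
    by (intro borel_measurable_continuous_onI continuous_intros continuous_slice rapid_fourier_space f)
  have "fourier_space (inv_fourier_space f) x = complex_of_real (1 / (2 * pi) ^ 3) * (LINT y|lborel. ?g y)"
    unfolding inv_fourier_space_reflect[abs_def] fourier_space_scale
    by (simp add: fourier_space_def fourier_def)
  also have "(LINT y|lborel. ?g y) = (LINT y|lborel. cis (snd x \<bullet> y) * fourier_space f (fst x, y))"
    by (subst integral_lborel_affine[OF _ m, of "-1" 0]) (simp_all add: inner_commute)
  also have "complex_of_real (1 / (2 * pi) ^ 3) * \<dots> = inv_fourier_space (fourier_space f) x"
    by (simp add: inv_fourier_space_def inv_fourier_def)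
  finally show ?thesis using inv_fourier_space_fourier_space[OF f] by simp
qed

text \<open>
The operator \<open>jap\<close> on a single matrix entry.
\<close>

definition jap_scalar :: "real \<Rightarrow> (spacetime \<Rightarrow> complex) \<Rightarrow> spacetime \<Rightarrow> complex" where
  "jap_scalar s f = inv_fourier_space (\<lambda>x. jap_symbol s (snd x) * fourier_space f x)"

lemma jap_entry: "jap s u x $ a $ b = jap_scalar s (\<lambda>y. u y $ a $ b) x"
  by (cases x) (simp add: jap_def jap_scalar_def inv_fourier_space_def fourier_space_def jap_symbol_def)

context
  fixes s :: real assumes s: "s \<le> 0"
begin

lemma rapid_jap_scalar: "rapid f \<Longrightarrow> rapid (jap_scalar s f)"
  unfolding jap_scalar_def by (intro rapid_inv_fourier_space rapid_jap_symbol_mult rapid_fourier_space s)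

lemma fourier_space_jap_scalar:
  "rapid f \<Longrightarrow> fourier_space (jap_scalar s f) x = jap_symbol s (snd x) * fourier_space f x"
  unfolding jap_scalar_def
  by (subst fourier_space_inv_fourier_space) (intro rapid_jap_symbol_mult rapid_fourier_space s | simp)+

lemma jap_scalar_add:
  assumes f: "rapid f" "rapid g"
  shows "jap_scalar s (\<lambda>x. f x + g x) = (\<lambda>x. jap_scalar s f x + jap_scalar s g x)"
  using f by (intro fourier_space_inj)
    (auto intro!: rapid_jap_scalar rapid_add simp: fourier_space_jap_scalar fourier_space_add rapid_jap_scalar rapid_add distrib_left)

lemma jap_scalar_scale:
  assumes f: "rapid f"
  shows "jap_scalar s (\<lambda>x. c * f x) = (\<lambda>x. c * jap_scalar s f x)"
  using f by (intro fourier_space_inj)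
    (auto intro!: rapid_jap_scalar rapid_scale simp: fourier_space_jap_scalar fourier_space_scale rapid_scale)

lemma jap_scalar_jap_scalar:
  assumes f: "rapid f" and r: "r \<le> 0"
  shows "jap_scalar r (jap_scalar s f) = jap_scalar (r + s) f"
  unfolding jap_scalar_def[of r] jap_scalar_def[of "r + s"]
  by (simp add: fourier_space_jap_scalar f jap_symbol_add flip: mult.assoc)

lemma pd_jap_scalar:
  assumes f: "rapid f" and \<mu>: "\<mu> \<le> 3"
  shows "pd \<mu> (jap_scalar s f) = jap_scalar s (pd \<mu> f)"
proof (rule fourier_space_inj)
  show "rapid (pd \<mu> (jap_scalar s f))" "rapid (jap_scalar s (pd \<mu> f))"
    by (intro rapid_pd rapid_jap_scalar f \<mu>)+
  show "fourier_space (pd \<mu> (jap_scalar s f)) x = fourier_space (jap_scalar s (pd \<mu> f)) x" for x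
  proof (cases "\<mu> = 0")
    case True
    have "fourier_space (pd 0 (jap_scalar s f)) = pd 0 (fourier_space (jap_scalar s f))"
      by (rule pd_eqI[symmetric]) (intro has_pd_fourier_space_time rapid_jap_scalar f)
    also have "fourier_space (jap_scalar s f) = (\<lambda>x. jap_symbol s (snd x) * fourier_space f x)"
      using fourier_space_jap_scalar[OF f] by blast
    also have "pd 0 (\<lambda>x. jap_symbol s (snd x) * fourier_space f x) =
       (\<lambda>x. jap_symbol s (snd x) * fourier_space (pd 0 f) x + 0)"
      using has_pd_mult[OF has_pd_jap_symbol[of 0 s] has_pd_fourier_space_time[OF f]]
      by (intro pd_eqI) (simp add: inner_snd_basis_vec)
    finally show ?thesis using True by (simp add: fourier_space_jap_scalar rapid_pd f)
  next
    case False
    thus ?thesis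
      using f \<mu> by (simp add: fourier_space_pd_space fourier_space_jap_scalar rapid_jap_scalar rapid_pd mult_ac)
  qed
qed

end

text \<open>
On the transform side spatial derivatives are multiplications, which commute with each other and
with the time derivative.
\<close>

lemma pd_commute_rapid:
  assumes f: "rapid f" and \<mu>: "\<mu> \<le> 3" and \<nu>: "\<nu> \<le> 3"
  shows "pd \<mu> (pd \<nu> f) = pd \<nu> (pd \<mu> f)"
proof -
  have ts: "pd 0 (pd \<nu> f) = pd \<nu> (pd 0 f)" if \<nu>: "\<nu> \<noteq> 0" "\<nu> \<le> 3" for \<nu>
  proof (rule fourier_space_inj)
    show "rapid (pd 0 (pd \<nu> f))" "rapid (pd \<nu> (pd 0 f))" using f \<nu> by (auto intro!: rapid_pd)
    have "fourier_space (pd 0 (pd \<nu> f)) = pd 0 (fourier_space (pd \<nu> f))"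
      by (rule pd_eqI[symmetric]) (intro has_pd_fourier_space_time rapid_pd f \<nu>)
    also have "fourier_space (pd \<nu> f) = (\<lambda>x. \<i> * (coord (of_nat \<nu>) x * fourier_space f x))"
      using fourier_space_pd_space[OF f \<nu>] by blast
    also have "pd 0 \<dots> = (\<lambda>x. \<i> * (coord (of_nat \<nu>) x * fourier_space (pd 0 f) x + 0 * fourier_space f x))"
      using has_pd_coord[of 0 "of_nat \<nu>"]
      by (intro pd_eqI has_pd_cmult has_pd_mult has_pd_fourier_space_time f) (simp add: basis_vec_def)
    finally show "fourier_space (pd 0 (pd \<nu> f)) x = fourier_space (pd \<nu> (pd 0 f)) x" for x
      using f \<nu> by (simp add: fourier_space_pd_space rapid_pd)
  qed
  have ss: "pd \<mu> (pd \<nu> f) = pd \<nu> (pd \<mu> f)" if "\<mu> \<noteq> 0" "\<nu> \<noteq> 0"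
  proof (rule fourier_space_inj)
    show "rapid (pd \<mu> (pd \<nu> f))" "rapid (pd \<nu> (pd \<mu> f))" using f \<mu> \<nu> by (auto intro!: rapid_pd)
    show "fourier_space (pd \<mu> (pd \<nu> f)) x = fourier_space (pd \<nu> (pd \<mu> f)) x" for x
      using that f \<mu> \<nu> by (simp add: fourier_space_pd_space rapid_pd mult_ac)
  qed
  show ?thesis using ts[of \<mu>] ts[of \<nu>] ss \<mu> \<nu> by (cases "\<mu> = 0"; cases "\<nu> = 0") auto
qed

text \<open>
On the transform side \<open>1 - \<Delta>\<close> is multiplication by \<open>jap_symbol 2\<close>.
\<close>

lemma jap_scalar_laplacian:
  assumes f: "rapid f"
  shows "jap_scalar (-2) (\<lambda>x. f x + (-1) * (\<Sum>i=1..3. pd i (pd i f) x)) = f"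
proof (rule fourier_space_inj)
  have r: "rapid (pd i (pd i f))" if "i \<in> {1..3}" for i using that f by (auto intro!: rapid_pd)
  have s: "(\<lambda>x. \<Sum>i=1..3. pd i (pd i f) x) = (\<lambda>x. pd 1 (pd 1 f) x + (pd 2 (pd 2 f) x + pd 3 (pd 3 f) x))"
    by (simp add: numeral_3_eq_3 numeral_2_eq_2 add.assoc)
  have rs: "rapid (\<lambda>x. \<Sum>i=1..3. pd i (pd i f) x)" using r by (rule rapid_sum)
  show rl: "rapid (jap_scalar (-2) (\<lambda>x. f x + (-1) * (\<Sum>i=1..3. pd i (pd i f) x)))"
    by (intro rapid_jap_scalar rapid_add rapid_scale rs f) simp
  show "rapid f" by fact
  fix x
  have "fourier_space (\<lambda>x. \<Sum>i=1..3. pd i (pd i f) x) x = - complex_of_real ((norm (snd x))\<^sup>2) * fourier_space f x"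
  proof -
    have F: "fourier_space (pd i (pd i f)) x = - complex_of_real ((snd x $ of_nat i)\<^sup>2) * fourier_space f x"
      if "i \<noteq> 0" "i \<le> 3" for i
    proof -
      have "fourier_space (pd i (pd i f)) x =
          (\<i> * \<i>) * (coord (of_nat i) x * coord (of_nat i) x) * fourier_space f x"
        by (simp only: fourier_space_pd_space[OF rapid_pd[OF f that(2)] that] fourier_space_pd_space[OF f that] mult_ac)
      thus ?thesis by (simp add: coord_def power2_eq_square)
    qed
    have N: "(norm (snd x))\<^sup>2 = (snd x $ of_nat 1)\<^sup>2 + ((snd x $ of_nat 2)\<^sup>2 + (snd x $ of_nat 3)\<^sup>2)"
      unfolding power2_norm_eq_inner inner_vec_def sum_3 by (simp add: power2_eq_square)
    have "fourier_space (\<lambda>x. \<Sum>i=1..3. pd i (pd i f) x) x = fourier_space (pd 1 (pd 1 f)) x +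
        (fourier_space (pd 2 (pd 2 f)) x + fourier_space (pd 3 (pd 3 f)) x)"
      unfolding s using r by (simp add: fourier_space_add rapid_add)
    also have "\<dots> = - complex_of_real ((norm (snd x))\<^sup>2) * fourier_space f x"
    proof -
      have "fourier_space (pd 1 (pd 1 f)) x = - complex_of_real ((snd x $ of_nat 1)\<^sup>2) * fourier_space f x"
        "fourier_space (pd 2 (pd 2 f)) x = - complex_of_real ((snd x $ of_nat 2)\<^sup>2) * fourier_space f x"
        "fourier_space (pd 3 (pd 3 f)) x = - complex_of_real ((snd x $ of_nat 3)\<^sup>2) * fourier_space f x"
        by (rule F; simp)+
      thus ?thesis unfolding N by (simp only: of_real_add minus_add_distrib distrib_right)
    qed
    finally show ?thesis .
  qed
  hence "fourier_space (\<lambda>x. f x + (-1) * (\<Sum>i=1..3. pd i (pd i f) x)) x =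
      jap_symbol 2 (snd x) * fourier_space f x"
    by (simp only: fourier_space_add[OF f rapid_scale[OF rs]] fourier_space_scale)
       (simp add: jap_symbol_def algebra_simps)
  hence "fourier_space (jap_scalar (-2) (\<lambda>x. f x + (-1) * (\<Sum>i=1..3. pd i (pd i f) x))) x =
      jap_symbol (-2) (snd x) * (jap_symbol 2 (snd x) * fourier_space f x)"
    by (subst fourier_space_jap_scalar[OF _ rapid_add[OF f rapid_scale[OF rs]]]) simp_all
  moreover have "jap_symbol (-2) (snd x) * jap_symbol 2 (snd x) = 1"
    using add_pos_nonneg[OF zero_less_one zero_le_power2[of "norm (snd x)"]]
    unfolding jap_symbol_add by (simp add: jap_symbol_def)
  ultimately show "fourier_space (jap_scalar (-2) (\<lambda>x. f x + (-1) * (\<Sum>i=1..3. pd i (pd i f) x))) x = fourier_space f x"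
    by (simp only: mult.assoc[symmetric] mult_1_left)
qed

section \<open>Matrix-valued fields\<close>

definition rapid_field :: "'n::finite field \<Rightarrow> bool" where
  "rapid_field u \<longleftrightarrow> (\<forall>a b. rapid (\<lambda>x. u x $ a $ b))"

lemma rapid_entry: "rapid_field u \<Longrightarrow> rapid (\<lambda>x. u x $ a $ b)"
  by (simp add: rapid_field_def)

lemma schwartz_imp_rapid_field: "schwartz u \<Longrightarrow> rapid_field u"
  by (simp add: rapid_field_def schwartz_imp_rapid)

lemma rapid_field_add: "rapid_field u \<Longrightarrow> rapid_field v \<Longrightarrow> rapid_field (\<lambda>x. u x + v x)"
  by (simp add: rapid_field_def rapid_add)

lemma rapid_field_scaleR: "rapid_field u \<Longrightarrow> rapid_field (\<lambda>x. c *\<^sub>R u x)"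
  by (simp add: rapid_field_def rapid_scale scaleR_conv_of_real)

lemma rapid_field_sum: "(\<And>i. i \<in> I \<Longrightarrow> rapid_field (u i)) \<Longrightarrow> rapid_field (\<lambda>x. \<Sum>i\<in>I. u i x)"
  by (simp add: rapid_field_def rapid_sum)

lemma rapid_field_matrix_mult: "rapid_field u \<Longrightarrow> rapid_field v \<Longrightarrow> rapid_field (\<lambda>x. u x ** v x)"
  by (simp add: rapid_field_def matrix_matrix_mult_def rapid_sum rapid_mult)

lemma has_vector_derivative_vec:
  assumes "\<And>i. ((\<lambda>s. f s $ i) has_vector_derivative D $ i) (at 0)"
  shows "(f has_vector_derivative D) (at (0::real))"
  using assms unfolding has_vector_derivative_at_0_iff by (intro vec_tendstoI) simp

lemma has_pd_field_entrywise:
  assumes u: "rapid_field u" and \<mu>: "\<mu> \<le> 3"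
  shows "has_pd \<mu> u (\<lambda>x. \<chi> a b. pd \<mu> (\<lambda>y. u y $ a $ b) x)"
  unfolding has_pd_def
proof
  fix x show "((\<lambda>s. u (x + s *\<^sub>R basis_vec \<mu>)) has_vector_derivative (\<chi> a b. pd \<mu> (\<lambda>y. u y $ a $ b) x)) (at 0)"
    using rapid_has_pd[OF rapid_entry[OF u] \<mu>]
    by (intro has_vector_derivative_vec) (simp add: has_pd_def)
qed

lemma pd_entry: "rapid_field u \<Longrightarrow> \<mu> \<le> 3 \<Longrightarrow> pd \<mu> u x $ a $ b = pd \<mu> (\<lambda>y. u y $ a $ b) x"
  by (simp add: pd_eqI[OF has_pd_field_entrywise])

lemma has_pd_field: "rapid_field u \<Longrightarrow> \<mu> \<le> 3 \<Longrightarrow> has_pd \<mu> u (pd \<mu> u)"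
  using has_pd_field_entrywise pd_eqI by metis

lemma rapid_field_pd: "rapid_field u \<Longrightarrow> \<mu> \<le> 3 \<Longrightarrow> rapid_field (pd \<mu> u)"
  by (auto simp: rapid_field_def[of "pd \<mu> u"] pd_entry intro: rapid_pd rapid_entry)

lemma pd_add: "rapid_field u \<Longrightarrow> rapid_field v \<Longrightarrow> \<mu> \<le> 3 \<Longrightarrow> pd \<mu> (\<lambda>x. u x + v x) = (\<lambda>x. pd \<mu> u x + pd \<mu> v x)"
  by (intro pd_eqI has_pd_add has_pd_field)

lemma pd_scaleR: "rapid_field u \<Longrightarrow> \<mu> \<le> 3 \<Longrightarrow> pd \<mu> (\<lambda>x. c *\<^sub>R u x) = (\<lambda>x. c *\<^sub>R pd \<mu> u x)"
  by (intro pd_eqI has_pd_linear[OF bounded_linear_scaleR_right] has_pd_field)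

lemma pd_zero: "pd \<mu> (\<lambda>x. 0) = (\<lambda>x. 0)"
  by (intro pd_eqI has_pd_const)

lemma rapid_field_zero: "rapid_field (\<lambda>x. 0)"
  by (simp add: rapid_field_def rapid_zero)

lemma pd_sum:
  assumes "\<And>i. i \<in> I \<Longrightarrow> rapid_field (u i)" and \<mu>: "\<mu> \<le> 3"
  shows "pd \<mu> (\<lambda>x. \<Sum>i\<in>I. u i x) = (\<lambda>x. \<Sum>i\<in>I. pd \<mu> (u i) x)"
  using assms(1)
proof (induction I rule: infinite_finite_induct)
  case (insert i I)
  thus ?case using \<mu> by (simp add: pd_add rapid_field_sum)
qed (simp_all add: pd_zero)

lemma pd_commute: "rapid_field u \<Longrightarrow> \<mu> \<le> 3 \<Longrightarrow> \<nu> \<le> 3 \<Longrightarrow> pd \<mu> (pd \<nu> u) = pd \<nu> (pd \<mu> u)"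
  by (rule ext) (simp add: vec_eq_iff pd_entry rapid_field_pd pd_commute_rapid rapid_entry)

context
  fixes s :: real assumes s: "s \<le> 0"
begin

lemma rapid_field_jap: "rapid_field u \<Longrightarrow> rapid_field (jap s u)"
  by (simp add: rapid_field_def jap_entry rapid_jap_scalar s)

lemma jap_add: "rapid_field u \<Longrightarrow> rapid_field v \<Longrightarrow> jap s (\<lambda>x. u x + v x) = (\<lambda>x. jap s u x + jap s v x)"
  by (rule ext) (simp add: vec_eq_iff jap_entry jap_scalar_add s rapid_entry)

lemma jap_scaleR: "rapid_field u \<Longrightarrow> jap s (\<lambda>x. c *\<^sub>R u x) = (\<lambda>x. c *\<^sub>R jap s u x)"
  by (rule ext) (simp add: vec_eq_iff jap_entry jap_scalar_scale s rapid_entry scaleR_conv_of_real)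

lemma jap_sum:
  assumes "\<And>i. i \<in> I \<Longrightarrow> rapid_field (u i)"
  shows "jap s (\<lambda>x. \<Sum>i\<in>I. u i x) = (\<lambda>x. \<Sum>i\<in>I. jap s (u i) x)"
  using assms
proof (induction I rule: infinite_finite_induct)
  case (insert i I)
  thus ?case by (simp add: jap_add rapid_field_sum)
qed (use jap_scaleR[OF rapid_field_zero, of 0] in simp_all)

lemma pd_jap: "rapid_field u \<Longrightarrow> \<mu> \<le> 3 \<Longrightarrow> pd \<mu> (jap s u) = jap s (pd \<mu> u)"
  by (rule ext) (simp add: vec_eq_iff pd_entry jap_entry rapid_field_jap pd_jap_scalar s rapid_entry)

end

lemma jap_riesz:
  assumes "rapid_field u" "n \<le> 3"
  shows "jap (-1) (riesz n u) = jap (-2) (pd n u)"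
proof (rule ext)
  fix x show "jap (-1) (riesz n u) x = jap (-2) (pd n u) x"
    using rapid_field_pd[OF assms]
    by (simp add: vec_eq_iff riesz_def jap_entry jap_scalar_jap_scalar rapid_entry)
qed

lemma jap_laplacian:
  assumes "rapid_field u"
  shows "jap (-2) (\<lambda>x. u x + (-1) *\<^sub>R (\<Sum>i=1..3. pd i (pd i u) x)) = u"
proof (rule ext)
  fix x
  have "(pd i (pd i u) y) $ a $ b = pd i (pd i (\<lambda>z. u z $ a $ b)) y" if "i \<in> {1..3}" for i y a b
    using that assms by (simp add: pd_entry rapid_field_pd)
  hence e: "(u y + (-1) *\<^sub>R (\<Sum>i=1..3. pd i (pd i u) y)) $ a $ b =
     u y $ a $ b + (-1) * (\<Sum>i=1..3. pd i (pd i (\<lambda>z. u z $ a $ b)) y)" for y a b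
    by simp
  show "jap (-2) (\<lambda>x. u x + (-1) *\<^sub>R (\<Sum>i=1..3. pd i (pd i u) x)) x = u x"
    unfolding vec_eq_iff jap_entry e using assms by (simp only: jap_scalar_laplacian rapid_entry) simp
qed

section \<open>Decomposition of the potential\<close>

lemma sum_1_3: "(\<Sum>i=1..3. f i) = f 1 + f 2 + f (3::nat)"
  by (simp add: numeral_3_eq_3 numeral_2_eq_2)

lemma comm_add_left: "comm (X + Y) Z = comm X Z + comm Y Z"
  and comm_add_right: "comm Z (X + Y) = comm Z X + comm Z Y"
  and comm_minus_left: "comm (- X) Z = - comm X Z"
  and comm_minus_right: "comm Z (- X) = - comm Z X"
  and comm_scaleR_left: "comm (c *\<^sub>R X) Z = c *\<^sub>R comm X Z"
  and comm_scaleR_right: "comm Z (c *\<^sub>R X) = c *\<^sub>R comm Z X"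
  and comm_skew: "comm X Z = - comm Z X"
  by (simp_all add: comm_def vec_eq_iff matrix_matrix_mult_def sum.distrib sum_subtractf sum_negf
      sum_distrib_left scaleR_sum_right algebra_simps)

lemma comm_sum_left: "comm (\<Sum>i\<in>I. X i) Z = (\<Sum>i\<in>I. comm (X i) Z)"
proof (induction I rule: infinite_finite_induct)
  case (insert i I) thus ?case by (simp add: comm_add_left)
qed (use comm_scaleR_left[of 0 0 Z] in simp_all)

lemma comm_sum_right: "comm Z (\<Sum>i\<in>I. X i) = (\<Sum>i\<in>I. comm Z (X i))"
proof (induction I rule: infinite_finite_induct)
  case (insert i I) thus ?case by (simp add: comm_add_right)
qed (use comm_scaleR_right[of Z 0 0] in simp_all)

text \<open>
This is the step that creates the null forms: contraction with \<open>eps i j k\<close> only sees the part of \<open>g\<close>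
that is antisymmetric in its first two indices.
\<close>

lemma sum_eps_antisym:
  fixes g :: "nat \<Rightarrow> nat \<Rightarrow> nat \<Rightarrow> nat \<Rightarrow> 'v::real_vector"
  shows "(\<Sum>i=1..3. \<Sum>j=1..3. \<Sum>k=1..3. \<Sum>l=1..3. \<Sum>m=1..3. (eps i j k * eps k l m) *\<^sub>R (g i j l m - g j i l m))
   = 2 *\<^sub>R (\<Sum>i=1..3. \<Sum>j=1..3. \<Sum>k=1..3. \<Sum>l=1..3. \<Sum>m=1..3. (eps i j k * eps k l m) *\<^sub>R g i j l m)"
  unfolding sum_1_3 by (simp add: eps_def scaleR_2)

abbreviation rapid_vec :: "(nat \<Rightarrow> 'n::finite field) \<Rightarrow> bool" where
  "rapid_vec V \<equiv> \<forall>k\<in>{1..3}. rapid_field (V k)"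

lemma rapid_field_curl: "rapid_vec V \<Longrightarrow> rapid_field (curl V i)"
  unfolding curl_def[abs_def] by (intro rapid_field_sum rapid_field_scaleR rapid_field_pd) auto

lemma rapid_field_divergence: "rapid_vec V \<Longrightarrow> rapid_field (divergence V)"
  unfolding divergence_def[abs_def] by (intro rapid_field_sum rapid_field_pd) auto

lemma rapid_field_vcross: "rapid_vec U \<Longrightarrow> rapid_vec V \<Longrightarrow> rapid_field (vcross U V i)"
  unfolding vcross_def[abs_def] by (intro rapid_field_sum rapid_field_scaleR rapid_field_matrix_mult) auto

lemma pd_curl:
  assumes "rapid_vec V" "\<mu> \<le> 3"
  shows "pd \<mu> (curl V i) = curl (\<lambda>k. pd \<mu> (V k)) i"
proof -
  have r: "rapid_field (pd j (V k))" if "j \<in> {1..3}" "k \<in> {1..3}" for j k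
    using that assms by (auto intro: rapid_field_pd)
  have "pd \<mu> (curl V i) = (\<lambda>x. \<Sum>j=1..3. \<Sum>k=1..3. eps i j k *\<^sub>R pd \<mu> (pd j (V k)) x)"
  proof -
    have "pd \<mu> (curl V i) = (\<lambda>x. \<Sum>j=1..3. pd \<mu> (\<lambda>x. \<Sum>k=1..3. eps i j k *\<^sub>R pd j (V k) x) x)"
      unfolding curl_def[abs_def] by (intro pd_sum rapid_field_sum rapid_field_scaleR r assms)
    also have "\<dots> = (\<lambda>x. \<Sum>j=1..3. \<Sum>k=1..3. pd \<mu> (\<lambda>x. eps i j k *\<^sub>R pd j (V k) x) x)"
      by (intro ext sum.cong refl fun_cong[OF pd_sum] rapid_field_scaleR r assms)
    also have "\<dots> = (\<lambda>x. \<Sum>j=1..3. \<Sum>k=1..3. eps i j k *\<^sub>R pd \<mu> (pd j (V k)) x)"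
      by (intro ext sum.cong refl fun_cong[OF pd_scaleR] r assms)
    finally show ?thesis .
  qed
  also have "\<dots> = curl (\<lambda>k. pd \<mu> (V k)) i"
    unfolding curl_def[abs_def] using assms by (intro ext sum.cong refl) (auto simp: pd_commute[of _ \<mu>])
  finally show ?thesis .
qed

lemma pd_divergence:
  assumes "rapid_vec V" "\<mu> \<le> 3"
  shows "pd \<mu> (divergence V) = divergence (\<lambda>k. pd \<mu> (V k))"
proof -
  have r: "rapid_field (pd k (V k))" if "k \<in> {1..3}" for k
    using that assms by (auto intro: rapid_field_pd)
  have "pd \<mu> (divergence V) = (\<lambda>x. \<Sum>k=1..3. pd \<mu> (pd k (V k)) x)"
    unfolding divergence_def[abs_def] by (intro pd_sum r assms)
  also have "\<dots> = divergence (\<lambda>k. pd \<mu> (V k))"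
    unfolding divergence_def[abs_def]
    using assms by (intro ext sum.cong refl) (auto simp: pd_commute[of _ \<mu>])
  finally show ?thesis .
qed

lemma curl_add:
  assumes "rapid_vec U" "rapid_vec V"
  shows "curl (\<lambda>k x. U k x + V k x) i = (\<lambda>x. curl U i x + curl V i x)"
proof
  fix x
  have "curl (\<lambda>k x. U k x + V k x) i x = (\<Sum>j=1..3. \<Sum>k=1..3. eps i j k *\<^sub>R pd j (U k) x + eps i j k *\<^sub>R pd j (V k) x)"
    unfolding curl_def using assms
    by (intro sum.cong refl) (simp add: pd_add scaleR_add_right)
  thus "curl (\<lambda>k x. U k x + V k x) i x = curl U i x + curl V i x"
    by (simp add: curl_def sum.distrib)
qed

lemma curl_cong: "(\<And>k. k \<in> {1..3} \<Longrightarrow> U k = V k) \<Longrightarrow> curl U i = curl V i"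
  unfolding curl_def[abs_def] by (intro ext sum.cong refl) simp

lemma curl_curl:
  assumes "rapid_vec A"
  shows "curl (curl A) i x = (\<Sum>j=1..3. \<Sum>k=1..3. \<Sum>l=1..3. \<Sum>m=1..3. (eps i j k * eps k l m) *\<^sub>R pd j (pd l (A m)) x)"
  unfolding curl_def[of "curl A"]
proof (intro sum.cong refl)
  fix j k assume j: "j \<in> {1..3::nat}"
  have "pd j (curl A k) x = (\<Sum>l=1..3. \<Sum>m=1..3. eps k l m *\<^sub>R pd l (pd j (A m)) x)"
    using assms j by (subst pd_curl) (auto simp: curl_def)
  also have "\<dots> = (\<Sum>l=1..3. \<Sum>m=1..3. eps k l m *\<^sub>R pd j (pd l (A m)) x)"
    using assms j by (intro sum.cong refl) (auto simp: pd_commute[of _ j])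
  finally show "eps i j k *\<^sub>R pd j (curl A k) x = (\<Sum>l=1..3. \<Sum>m=1..3. (eps i j k * eps k l m) *\<^sub>R pd j (pd l (A m)) x)"
    by (simp add: scaleR_sum_right)
qed

lemma curl_curl_eq_grad_div_minus_laplacian:
  assumes A: "rapid_vec A" and i: "i \<in> {1..3}"
  shows "curl (curl A) i x = pd i (divergence A) x - (\<Sum>j=1..3. pd j (pd j (A i)) x)"
proof -
  have "i = 1 \<or> i = 2 \<or> i = 3" using i by auto
  moreover have c: "pd \<mu> (pd \<nu> (A k)) = pd \<nu> (pd \<mu> (A k))" if "k \<in> {1..3}" "\<mu> \<le> 3" "\<nu> \<le> 3" for \<mu> \<nu> k
    using that A by (intro pd_commute) auto
  have "pd i (divergence A) x = (\<Sum>j=1..3. pd j (pd i (A j)) x)"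
    using A i by (subst pd_divergence) (auto simp: divergence_def)
  ultimately show ?thesis
    unfolding curl_curl[OF A] sum_1_3 by (elim disjE) (simp_all add: eps_def)
qed

text \<open>
Apply \<open>jap (-2)\<close> to \<open>(1 - \<Delta>) A = - \<nabla>(\<nabla> \<cdot> A) + \<nabla> \<times> \<nabla> \<times> A + A\<close>.
\<close>

lemma hodge_decomposition:
  assumes A: "rapid_vec A" and i: "i \<in> {1..3}"
  shows "A i x = cf_part A i x + df_part A i x + jap (-2) (A i) x"
proof -
  have r: "rapid_field (curl (curl A) i)" "rapid_field (pd i (divergence A))" "rapid_field (A i)"
    using A i by (auto intro!: rapid_field_curl rapid_field_pd rapid_field_divergence)
  have "A i x = jap (-2) (\<lambda>x. A i x + (-1) *\<^sub>R (\<Sum>j=1..3. pd j (pd j (A i)) x)) x"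
    using jap_laplacian[OF r(3)] by simp
  also have "(\<lambda>x. A i x + (-1) *\<^sub>R (\<Sum>j=1..3. pd j (pd j (A i)) x)) =
      (\<lambda>x. ((-1) *\<^sub>R pd i (divergence A) x + curl (curl A) i x) + A i x)"
    unfolding curl_curl_eq_grad_div_minus_laplacian[OF A i] by simp
  also have "jap (-2) \<dots> x = (-1) *\<^sub>R jap (-2) (pd i (divergence A)) x + jap (-2) (curl (curl A) i) x + jap (-2) (A i) x"
    using r by (simp only: jap_add jap_scaleR rapid_field_add rapid_field_scaleR)
  finally show ?thesis by (simp add: cf_part_def df_part_def)
qed

lemma pd_cf_part:
  assumes A: "rapid_vec A" and \<beta>: "\<beta> \<le> 3" and i: "i \<in> {1..3}"
  shows "pd \<beta> (cf_part A i) = (\<lambda>x. - jap (-2) (pd i (pd \<beta> (divergence A))) x)"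
proof -
  have r: "rapid_field (divergence A)" using A by (rule rapid_field_divergence)
  have "pd \<beta> (cf_part A i) = pd \<beta> (\<lambda>x. (-1) *\<^sub>R jap (-2) (pd i (divergence A)) x)"
    by (simp add: cf_part_def[abs_def])
  also have "\<dots> = (\<lambda>x. (-1) *\<^sub>R jap (-2) (pd \<beta> (pd i (divergence A))) x)"
    using i \<beta> r by (subst pd_scaleR) (auto intro!: rapid_field_jap rapid_field_pd simp: pd_jap rapid_field_pd)
  finally show ?thesis using i \<beta> r by (simp add: pd_commute[of _ \<beta>])
qed

lemma pd_df_part:
  "rapid_vec A \<Longrightarrow> \<beta> \<le> 3 \<Longrightarrow> pd \<beta> (df_part A i) = df_part (\<lambda>k. pd \<beta> (A k)) i"
proof -
  assume A: "rapid_vec A" and \<beta>: "\<beta> \<le> 3"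
  have A': "rapid_vec (curl A)" using A by (auto intro: rapid_field_curl)
  have "pd \<beta> (df_part A i) = jap (-2) (pd \<beta> (curl (curl A) i))"
    unfolding df_part_def by (intro pd_jap rapid_field_curl A' \<beta>) simp
  also have "pd \<beta> (curl (curl A) i) = curl (curl (\<lambda>k. pd \<beta> (A k))) i"
    unfolding pd_curl[OF A' \<beta>] pd_curl[OF A \<beta>] by (rule refl)
  finally show ?thesis by (simp add: df_part_def)
qed

lemma df_part_expand:
  assumes A: "rapid_vec A"
  shows "df_part A i x = (\<Sum>j=1..3. \<Sum>k=1..3. \<Sum>l=1..3. \<Sum>m=1..3.
     (eps i j k * eps k l m) *\<^sub>R jap (-2) (pd j (pd l (A m))) x)"
proof -
  have r: "rapid_field (pd j (pd l (A m)))" if "j \<in> {1..3}" "l \<in> {1..3}" "m \<in> {1..3}" for j l m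
    using that A by (auto intro!: rapid_field_pd)
  have "df_part A i x = jap (-2) (\<lambda>x. \<Sum>j=1..3. \<Sum>k=1..3. \<Sum>l=1..3. \<Sum>m=1..3. (eps i j k * eps k l m) *\<^sub>R pd j (pd l (A m)) x) x"
    unfolding df_part_def curl_curl[OF A, abs_def] by (rule refl)
  also have "\<dots> = (\<Sum>j=1..3. \<Sum>k=1..3. \<Sum>l=1..3. \<Sum>m=1..3.
     jap (-2) (\<lambda>x. (eps i j k * eps k l m) *\<^sub>R pd j (pd l (A m)) x) x)"
    by (rule trans[OF fun_cong[OF jap_sum]], simp, (intro rapid_field_sum rapid_field_scaleR r; assumption),
        intro sum.cong refl)+
  also have "\<dots> = (\<Sum>j=1..3. \<Sum>k=1..3. \<Sum>l=1..3. \<Sum>m=1..3.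
     (eps i j k * eps k l m) *\<^sub>R jap (-2) (pd j (pd l (A m))) x)"
    by (intro sum.cong refl, subst jap_scaleR, simp, intro r, assumption+, rule refl)
  finally show ?thesis .
qed

lemma spatial_curvature_eq_curl_plus_vcross:
  assumes "i \<in> {1..3}"
  shows "spatial_curvature (curvature A) i = (\<lambda>x. curl A i x + vcross A A i x)"
proof -
  have "i = 1 \<or> i = 2 \<or> i = 3" using assms by auto
  thus ?thesis
    by (elim disjE) (auto simp: spatial_curvature_def curvature_def curl_def vcross_def sum_1_3 eps_def comm_def fun_eq_iff simp del: One_nat_def)
qed

text \<open>
In Lorenz gauge the divergence of the spatial potential is the time derivative of \<open>A 0\<close>, so the curl-free
part is built from \<open>A 0\<close> alone.
\<close>

lemma Gamma1_eq:
  assumes A: "\<And>\<alpha>. \<alpha> \<in> {0..3} \<Longrightarrow> rapid_field (A \<alpha>)" and L: "lorenz_gauge A" and \<beta>: "\<beta> \<le> 3"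
  shows "Gamma1 A \<beta> x = - comm (A 0 x) (pd \<beta> (A 0) x) +
    (\<Sum>i=1..3. comm (cf_part A i x) (pd \<beta> (cf_part A i) x))"
proof -
  have V: "rapid_vec A" using A by simp
  have A0: "rapid_field (A 0)" using A by simp
  have d: "divergence A = pd 0 (A 0)"
  proof
    fix x
    have "(\<Sum>\<alpha>=0..3. raise (\<lambda>\<mu>. pd \<mu> (A \<alpha>) x) \<alpha>) = - pd 0 (A 0) x + divergence A x"
      unfolding divergence_def sum_1_3 by (simp add: raise_def numeral_3_eq_3 numeral_2_eq_2)
    thus "divergence A x = pd 0 (A 0) x" using L by (simp add: lorenz_gauge_def)
  qed
  have "comm (cf_part A i x) (pd \<beta> (cf_part A i) x) =
      comm (jap (- 1) (riesz i (pd 0 (A 0))) x) (jap (- 1) (riesz i (pd 0 (pd \<beta> (A 0)))) x)"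
    if i: "i \<in> {1..3}" for i
    using A0 i \<beta>
    by (simp add: pd_cf_part[OF V \<beta> i] cf_part_def d jap_riesz rapid_field_pd comm_minus_left comm_minus_right
        pd_commute[of "A 0" 0 \<beta>])
  thus ?thesis unfolding Gamma1_def by simp
qed

text \<open>
The curl-free part is the gradient of \<open>- jap (-2) (divergence A)\<close>, and the divergence-free part is a
double curl. A commutator of the two is a contraction of first derivatives with \<open>eps i j k\<close>, and
antisymmetrising in \<open>i\<close> and \<open>j\<close> turns it into half of a null form \<open>Q i j\<close>. The second group of terms of
\<open>Gamma2\<close> has the opposite sign because there the curl-free factor stands on the right.
\<close>

lemma Gamma2_eq:
  assumes A: "rapid_vec A" and \<beta>: "\<beta> \<le> 3"
  shows "Gamma2 A \<beta> x = (\<Sum>i=1..3. comm (cf_part A i x) (pd \<beta> (df_part A i) x) + comm (df_part A i x) (pd \<beta> (cf_part A i) x))"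
proof -
  have A\<beta>: "rapid_vec (\<lambda>k. pd \<beta> (A k))" using A \<beta> by (auto intro: rapid_field_pd)
  have pot: "(\<lambda>y. \<Sum>n=1..3. jap (- 1) (riesz n (V n)) y) = jap (-2) (divergence V)" if V: "rapid_vec V" for V :: "nat \<Rightarrow> 'a field"
  proof -
    have "jap (-2) (divergence V) = (\<lambda>y. \<Sum>n=1..3. jap (-2) (pd n (V n)) y)"
      unfolding divergence_def[abs_def] using V by (intro jap_sum rapid_field_pd) auto
    also have "\<dots> = (\<lambda>y. \<Sum>n=1..3. jap (- 1) (riesz n (V n)) y)"
      using V by (intro ext sum.cong refl) (simp add: jap_riesz)
    finally show ?thesis by simp
  qed
  have c: "pd i (jap (-2) (divergence A)) x = - cf_part A i x" if i: "i \<in> {1..3}" for i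
    using i A by (simp add: pd_jap rapid_field_divergence cf_part_def)
  have c': "pd i (jap (-2) (divergence (\<lambda>k. pd \<beta> (A k)))) x = - pd \<beta> (cf_part A i) x" if i: "i \<in> {1..3}" for i
    using i rapid_field_divergence[OF A\<beta>] by (simp add: pd_jap pd_cf_part[OF A \<beta> i] pd_divergence[OF A \<beta>])
  have w: "pd j (jap (-1) (riesz l (V m))) x = jap (-2) (pd j (pd l (V m))) x"
    if "rapid_vec V" "j \<in> {1..3}" "l \<in> {1..3}" "m \<in> {1..3}" for j l m and V :: "nat \<Rightarrow> 'a field"
    using that by (simp add: jap_riesz pd_jap rapid_field_pd)
  define W where "W j l m = jap (-2) (pd j (pd l (A m))) x" for j l m
  define W' where "W' j l m = jap (-2) (pd j (pd l (pd \<beta> (A m)))) x" for j l m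
  \<comment> \<open>Both mixed commutators at once, the curl-free factor carrying the index \<open>i\<close>.\<close>
  define g where "g i j l m = comm (W j l m) (pd \<beta> (cf_part A i) x) + comm (cf_part A i x) (W' j l m)" for i j l m
  have "Gamma2 A \<beta> x = - (1/2) *\<^sub>R (\<Sum>i=1..3. \<Sum>j=1..3. \<Sum>k=1..3. \<Sum>l=1..3. \<Sum>m=1..3.
      (eps i j k * eps k l m) *\<^sub>R (- g i j l m - - g j i l m))"
    unfolding Gamma2_def pot[OF A] pot[OF A\<beta>]
  proof (intro arg_cong[where f="(*\<^sub>R) (- (1/2))"] sum.cong refl arg_cong2[where f="(*\<^sub>R)"])
    fix i j k l m assume i: "i \<in> {1..3::nat}" "j \<in> {1..3::nat}" "l \<in> {1..3::nat}" "m \<in> {1..3::nat}"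
    show "Q i j (jap (- 2) (divergence A)) (jap (- 1) (riesz l (pd \<beta> (A m)))) x -
        Q i j (jap (- 2) (divergence (\<lambda>k. pd \<beta> (A k)))) (jap (- 1) (riesz l (A m))) x = - g i j l m - - g j i l m"
      unfolding Q_def c[OF i(1)] c[OF i(2)] c'[OF i(1)] c'[OF i(2)] w[OF A i(1,3,4)] w[OF A i(2,3,4)]
        w[OF A\<beta> i(1,3,4)] w[OF A\<beta> i(2,3,4)]
      by (simp add: g_def W_def W'_def comm_minus_left comm_skew[of "pd \<beta> (cf_part A _) x"])
  qed
  also have "\<dots> = (\<Sum>i=1..3. \<Sum>j=1..3. \<Sum>k=1..3. \<Sum>l=1..3. \<Sum>m=1..3. (eps i j k * eps k l m) *\<^sub>R g i j l m)"
    unfolding sum_eps_antisym by (simp add: sum_negf)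
  also have "\<dots> = (\<Sum>i=1..3. comm (cf_part A i x) (pd \<beta> (df_part A i) x) + comm (df_part A i x) (pd \<beta> (cf_part A i) x))"
    unfolding pd_df_part[OF A \<beta>] df_part_expand[OF A] df_part_expand[OF A\<beta>] g_def W_def W'_def
    by (simp add: comm_sum_left comm_sum_right comm_scaleR_left comm_scaleR_right sum.distrib scaleR_add_right add.commute)
  finally show ?thesis .
qed

text \<open>
The spatial curvature is \<open>curl A\<close> plus the cross product of \<open>A\<close> with itself. Solving for \<open>curl A\<close> writes the
divergence-free part as a difference, and the four terms of \<open>Gamma3\<close> are the expansion of its
commutator with its derivative.
\<close>

lemma Gamma3_eq:
  assumes A: "rapid_vec A" and \<beta>: "\<beta> \<le> 3"
  shows "Gamma3 A (curvature A) \<beta> x = (\<Sum>i=1..3. comm (df_part A i x) (pd \<beta> (df_part A i) x))"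
proof -
  let ?F = "spatial_curvature (curvature A)"
  let ?X = "vcross A A"
  have X: "rapid_vec ?X" and C: "rapid_vec (curl A)"
    using A by (auto intro: rapid_field_vcross rapid_field_curl)
  have F: "rapid_vec ?F" using X C by (simp add: spatial_curvature_eq_curl_plus_vcross rapid_field_add)
  have "curl ?F i = curl (\<lambda>k x. curl A k x + ?X k x) i" for i
    by (rule curl_cong) (rule spatial_curvature_eq_curl_plus_vcross)
  hence cF: "curl ?F i = (\<lambda>x. curl (curl A) i x + curl ?X i x)" for i
    by (simp only: curl_add[OF C X])
  have J: "jap (-2) (curl ?F i) = (\<lambda>x. df_part A i x + jap (-2) (curl ?X i) x)" for i
    unfolding cF df_part_def by (intro jap_add rapid_field_curl X C) simp
  have rd: "rapid_field (df_part A i)" for i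
    unfolding df_part_def by (intro rapid_field_jap rapid_field_curl C) simp
  have rX: "rapid_field (jap (-2) (curl ?X i))" for i
    by (intro rapid_field_jap rapid_field_curl X) simp
  have pX: "jap (-2) (pd \<beta> (curl ?X i)) = pd \<beta> (jap (-2) (curl ?X i))" for i
    by (rule pd_jap[symmetric]) (intro rapid_field_curl X \<beta> | simp)+
  have "jap (-2) (curl (\<lambda>k. pd \<beta> (?F k)) i) = pd \<beta> (jap (-2) (curl ?F i))" for i
    unfolding pd_curl[OF F \<beta>, symmetric]
    by (rule pd_jap[symmetric]) (intro rapid_field_curl F \<beta> | simp)+
  hence J': "jap (-2) (curl (\<lambda>k. pd \<beta> (?F k)) i) = (\<lambda>x. pd \<beta> (df_part A i) x + pd \<beta> (jap (-2) (curl ?X i)) x)" for i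
    unfolding J by (simp only: pd_add[OF rd rX \<beta>])
  show ?thesis
    unfolding Gamma3_def Let_def vcomm_def J J' pX
    by (simp add: comm_add_left comm_add_right flip: sum_subtractf sum.distrib)
qed

theorem lemma2:
  fixes \<gg> :: "(complex ^ 'n::finite ^ 'n) set"
    and A :: "nat \<Rightarrow> 'n field"
    and \<beta> :: nat
    and x :: spacetime
  assumes "\<gg> = so_real \<or> \<gg> = su_complex"
    and "\<And>\<alpha> y. \<alpha> \<in> {0..3} \<Longrightarrow> A \<alpha> y \<in> \<gg>"
    and "\<And>\<alpha>. \<alpha> \<in> {0..3} \<Longrightarrow> schwartz (A \<alpha>)"
    and "lorenz_gauge A"
    and "\<beta> \<in> {0..3}"
  shows "(\<Sum>\<alpha>=0..3. comm (raise (\<lambda>\<mu>. A \<mu> x) \<alpha>) (pd \<beta> (A \<alpha>) x)) =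
    Gamma1 A \<beta> x + Gamma2 A \<beta> x + Gamma3 A (curvature A) \<beta> x + Gamma4 A \<beta> x"
proof -
  have A: "rapid_field (A \<alpha>)" if "\<alpha> \<in> {0..3}" for \<alpha>
    using assms(3)[OF that] by (rule schwartz_imp_rapid_field)
  have V: "rapid_vec A" using A by simp
  have \<beta>: "\<beta> \<le> 3" using assms(5) by simp
  have C: "rapid_vec (curl A)" using V by (auto intro: rapid_field_curl)
  have D: "pd \<beta> (A i) x = pd \<beta> (cf_part A i) x + pd \<beta> (df_part A i) x + jap (-2) (pd \<beta> (A i)) x"
    if i: "i \<in> {1..3}" for i
  proof -
    have r: "rapid_field (cf_part A i)"
      using rapid_field_scaleR[OF rapid_field_jap[OF _ rapid_field_pd[OF rapid_field_divergence[OF V]]], of "-2" i "-1"] i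
      by (simp add: cf_part_def[abs_def])
    have r': "rapid_field (df_part A i)"
      unfolding df_part_def by (intro rapid_field_jap rapid_field_curl C) simp
    have r'': "rapid_field (jap (-2) (A i))" using V i by (auto intro: rapid_field_jap)
    have "pd \<beta> (A i) = pd \<beta> (\<lambda>x. (cf_part A i x + df_part A i x) + jap (-2) (A i) x)"
      by (intro arg_cong[where f="pd \<beta>"] ext hodge_decomposition V i)
    also have "\<dots> = (\<lambda>x. (pd \<beta> (cf_part A i) x + pd \<beta> (df_part A i) x) + pd \<beta> (jap (-2) (A i)) x)"
      by (simp only: pd_add r r' r'' rapid_field_add \<beta>)
    also have "pd \<beta> (jap (-2) (A i)) = jap (-2) (pd \<beta> (A i))"
      using V i \<beta> by (intro pd_jap) auto
    finally show ?thesis by (rule fun_cong)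
  qed
  have "(\<Sum>\<alpha>=0..3. comm (raise (\<lambda>\<mu>. A \<mu> x) \<alpha>) (pd \<beta> (A \<alpha>) x)) =
      - comm (A 0 x) (pd \<beta> (A 0) x) + (\<Sum>i=1..3. comm (A i x) (pd \<beta> (A i) x))"
    unfolding sum_1_3 by (simp add: raise_def comm_minus_left numeral_3_eq_3 numeral_2_eq_2)
  also have "(\<Sum>i=1..3. comm (A i x) (pd \<beta> (A i) x)) =
      (\<Sum>i=1..3. comm (cf_part A i x) (pd \<beta> (cf_part A i) x))
      + (\<Sum>i=1..3. comm (cf_part A i x) (pd \<beta> (df_part A i) x) + comm (df_part A i x) (pd \<beta> (cf_part A i) x))
      + (\<Sum>i=1..3. comm (df_part A i x) (pd \<beta> (df_part A i) x)) + Gamma4 A \<beta> x"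
    unfolding Gamma4_def vcomm_def sum.distrib[symmetric]
  proof (rule sum.cong[OF refl])
    fix i assume i: "i \<in> {1..3::nat}"
    have "comm (A i x) (pd \<beta> (A i) x) =
        comm (cf_part A i x + df_part A i x) (pd \<beta> (A i) x) + comm (jap (-2) (A i) x) (pd \<beta> (A i) x)"
      by (subst hodge_decomposition[OF V i]) (simp only: comm_add_left)
    also have "comm (cf_part A i x + df_part A i x) (pd \<beta> (A i) x) =
        comm (cf_part A i x + df_part A i x) (pd \<beta> (cf_part A i) x + pd \<beta> (df_part A i) x) +
        comm (cf_part A i x + df_part A i x) (jap (-2) (pd \<beta> (A i)) x)"
      unfolding D[OF i] by (simp only: comm_add_right)
    finally show "comm (A i x) (pd \<beta> (A i) x) =
        comm (cf_part A i x) (pd \<beta> (cf_part A i) x) +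
        (comm (cf_part A i x) (pd \<beta> (df_part A i) x) + comm (df_part A i x) (pd \<beta> (cf_part A i) x)) +
        comm (df_part A i x) (pd \<beta> (df_part A i) x) +
        (comm (cf_part A i x + df_part A i x) (jap (-2) (pd \<beta> (A i)) x) + comm (jap (-2) (A i) x) (pd \<beta> (A i) x))"
      by (simp add: comm_add_left comm_add_right)
  qed
  moreover have "Gamma1 A \<beta> x = - comm (A 0 x) (pd \<beta> (A 0) x) +
      (\<Sum>i=1..3. comm (cf_part A i x) (pd \<beta> (cf_part A i) x))"
    by (intro Gamma1_eq A assms(4) \<beta>)
  ultimately show ?thesis
    unfolding Gamma2_eq[OF V \<beta>] Gamma3_eq[OF V \<beta>] by simp
qed

end
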